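(* Let $c=0$, $\eta\ge 0$, and let $F$ be a continuous distribution with support $[0,1]$ and mean $\mu$. Then buyer-optimal information exists and induces trade with probability one (that is, if $G$ is buyer-optimal, then $\mathbb{P}_G[s\ge p^*(H)]=1$ for every admissible seller belief $H$). Moreover, for some $r^*\le B^*$ in $[0,1]$, the buyer-optimal distribution $G$ can be chosen so that its support is $[r^*,B^*]$ and $$\mathbb{P}_G[s\ge p]=I_\eta(r^*/p)\qquad\text{for all } r^*<p\le B^*,$$ and under this $G$ the seller charges $r^*$ under every admissible belief, i.e. $p^*(H)=r^*$ for every $H$ with $D_{KL}(H\|G)\le\eta$.
   Context: Model. A seller with production cost $c=0$ sells one unit to a buyer with value $v\sim F$. The buyer chooses an information structure; signals are normalized to equal the induced posterior expectation $s$ of $v$, and $G$ denotes the distribution (and CDF) of $s$. A distribution $G$ on $[0,1]$ is Bayes plausible with respect to $F$ if $\int_0^x G(s)\,ds\le\int_0^x F(s)\,ds$ for all $x\in[0,1]$ and $\int_0^1 s\,dG(s)=\mu$; the buyer may choose any Bayes plausible $G$. Divergence. $D_{KL}(H\|G)=\int\log(dH/dG)\,dH$ if $H$ is absolutely continuous with respect to $G$, and $+\infty$ otherwise. Given $G$, a seller belief $H$ (a probability distribution on $[0,1]$, not required to be Bayes plausible) is admissible if $D_{KL}(H\|G)\le\eta$. Seller. With belief $H$ the seller charges $p^*(H)=\min\arg\max_{p\in[0,1]}\,p\,\mathbb{P}_H[s\ge p]$. The buyer buys iff $s\ge p$. Buyer. The robust surplus of $G$ is $\inf_{H:\,D_{KL}(H\|G)\le\eta}\int_{p^*(H)}^1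 (s-p^*(H))\,dG(s)$. A Bayes plausible $G$ is buyer-optimal if it maximizes the robust surplus over all Bayes plausible distributions. Disagreement inversion. Let $d_{KL}(x\|y)=x\log(x/y)+(1-x)\log\frac{1-x}{1-y}$. For $\tilde\eta\ge0$ and $x\in(0,1)$, $I_{\tilde\eta}(x)\in[0,1]$ is the unique value weakly below $x$ with $d_{KL}(x\|I_{\tilde\eta}(x))=\tilde\eta$; by convention $I_{\tilde\eta}(0)=0$ and $I_{\tilde\eta}(1)=e^{-\tilde\eta}$. *)

theory Defs
  imports "HOL-Probability.Probability"
begin

definition unit_distribution :: "real measure \<Rightarrow> bool" where
  "unit_distribution M \<longleftrightarrow> real_distribution M \<and> measure M {0..1} = 1"

text \<open>Topological support: the points all of whose neighbourhoods have positive mass.\<close>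

definition msupport :: "real measure \<Rightarrow> real set" where
  "msupport M = {x. \<forall>U. open U \<and> x \<in> U \<longrightarrow> measure M U > 0}"

definition bayes_plausible :: "real measure \<Rightarrow> real measure \<Rightarrow> bool" where
  "bayes_plausible F G \<longleftrightarrow>
     unit_distribution G \<and>
     (\<forall>x\<in>{0..1}. (LBINT s:{0..x}. cdf G s) \<le> (LBINT s:{0..x}. cdf F s)) \<and>
     (LINT s|G. s) = (LINT v|F. v)"

text \<open>The library's \<open>KL_divergence (exp 1) G H\<close> is the integral of \<open>ln (dH/dG)\<close> with respect to
  \<open>H\<close> (the reference measure comes first), but it is real-valued and is \<open>0\<close> when the integrand is
  not integrable. The negative part of \<open>ln (dH/dG)\<close> is always \<open>H\<close>-integrable, because
  \<open>t * ln t \<ge> - exp (- 1)\<close> for \<open>t > 0\<close>, so in that case the divergence is infinite.\<close>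

definition D_KL :: "real measure \<Rightarrow> real measure \<Rightarrow> ereal" where
  "D_KL H G =
     (if absolutely_continuous G H \<and> integrable H (entropy_density (exp 1) G H)
      then ereal (KL_divergence (exp 1) G H) else \<infinity>)"

definition admissible :: "real \<Rightarrow> real measure \<Rightarrow> real measure \<Rightarrow> bool" where
  "admissible \<eta> G H \<longleftrightarrow> unit_distribution H \<and> D_KL H G \<le> ereal \<eta>"

text \<open>The minimum exists: \<open>p \<mapsto> p * measure H {p..}\<close> is upper semicontinuous on \<open>{0..1}\<close>.\<close>

definition seller_price :: "real measure \<Rightarrow> real" where
  "seller_price H = (LEAST p. is_arg_max (\<lambda>p. p * measure H {p..}) (\<lambda>p. p \<in> {0..1}) p)"

definition buyer_surplus :: "real measure \<Rightarrow> real \<Rightarrow> real" where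
  "buyer_surplus G p = (LINT s:{p..1}|G. s - p)"

text \<open>For \<open>\<eta> \<ge> 0\<close> and a distribution \<open>G\<close> on the unit interval, the infimum is over a set that is
  bounded below by \<open>0\<close> and nonempty (\<open>G\<close> itself is admissible).\<close>

definition robust_surplus :: "real \<Rightarrow> real measure \<Rightarrow> real" where
  "robust_surplus \<eta> G = (INF H\<in>{H. admissible \<eta> G H}. buyer_surplus G (seller_price H))"

definition buyer_optimal :: "real \<Rightarrow> real measure \<Rightarrow> real measure \<Rightarrow> bool" where
  "buyer_optimal \<eta> F G \<longleftrightarrow> is_arg_max (robust_surplus \<eta>) (bayes_plausible F) G"

definition d_KL :: "real \<Rightarrow> real \<Rightarrow> real" where
  "d_KL x y = x * ln (x / y) + (1 - x) * ln ((1 - x) / (1 - y))"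

text \<open>The value \<open>y = 0\<close> is excluded because there the divergence is infinite, which the real-valued
  \<open>d_KL\<close> does not represent. The inversion is only meaningful for \<open>x\<close> in the unit interval.\<close>

definition disagreement_inv :: "real \<Rightarrow> real \<Rightarrow> real" where
  "disagreement_inv \<eta> x =
     (if x = 0 then 0
      else if x = 1 then exp (- \<eta>)
      else (THE y. 0 < y \<and> y \<le> x \<and> d_KL x y = \<eta>))"

end

theory Submission
  imports Defs
begin

text \<open>
  Let \<open>Y \<ge> 1\<close> have \<open>P (Y \<ge> y) = I (1 / y)\<close>, where \<open>I\<close> inverts the binary divergence at level
  \<open>\<eta>\<close>. The candidate laws are those of \<open>min (r * Y) B\<close>. Under them the data processing inequality
  gives \<open>p * H {p..} \<le> r\<close> for every admissible \<open>H\<close>, so the seller always charges \<open>r\<close>.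

  Write \<open>\<rho> G x = E min s x\<close>; Bayes plausibility says \<open>\<rho> F \<le> \<rho> G\<close> with equality at 1, and the
  buyer's surplus at price \<open>p\<close> is \<open>\<rho> G 1 - \<rho> G p\<close>. Let \<open>p\<close> be the supremum of the prices that
  admissible beliefs induce under \<open>G\<close>, and \<open>r = \<rho> G p\<close>. No exponential tilt at \<open>t > p\<close> makes \<open>t\<close>
  better than all prices up to \<open>p\<close>, which forces \<open>G {t..} \<le> I (r / (t - p + r))\<close>: above \<open>p\<close>, the
  law \<open>G\<close> is dominated by that of \<open>r * Y\<close> shifted up by \<open>p - r\<close>. Hence \<open>\<rho> F \<le> \<rho> G \<le> \<rho> (r * Y)\<close>,
  so \<open>r\<close> is a feasible price for the candidate laws and yields at least the robust surplus of \<open>G\<close>.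
  The least feasible \<open>r\<close> is therefore optimal; there \<open>\<rho> (r * Y)\<close> touches \<open>\<rho> F\<close>, and a strict
  shift \<open>r < p\<close>, i.e. trade with probability below one, would leave a gap.
\<close>

section \<open>The binary divergence and its inversion\<close>

lemma one_minus_inverse_le_ln:
  fixes t :: real
  assumes "t > 0"
  shows "1 - 1 / t \<le> ln t"
  using ln_le_minus_one[of "1 / t"] assms by (simp add: ln_div)

lemma d_KL_refl: "0 < x \<Longrightarrow> x < 1 \<Longrightarrow> d_KL x x = 0"
  by (simp add: d_KL_def)

text \<open>Bounding both logarithms of the difference by \<open>ln t \<ge> 1 - 1 / t\<close>,
  strictly for the first, leaves \<open>(y2 - y1) * (x - y2) / (y2 * (1 - y2))\<close>, which is
  nonnegative for \<open>y2 \<le> x\<close>.\<close>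

lemma d_KL_strict_antimono:
  assumes "0 < y1" "y1 < y2" "y2 \<le> x" "x < 1"
  shows "d_KL x y2 < d_KL x y1"
proof -
  have "d_KL x y1 - d_KL x y2 = x * ln (y2 / y1) + (1 - x) * ln ((1 - y2) / (1 - y1))"
    using assms by (simp add: d_KL_def ln_div algebra_simps)
  moreover have "x * (1 - y1 / y2) < x * ln (y2 / y1)"
  proof -
    have "ln (y1 / y2) < y1 / y2 - 1"
      using assms ln_le_minus_one[of "y1 / y2"] ln_eq_minus_one[of "y1 / y2"] by fastforce
    then show ?thesis using assms by (simp add: ln_div)
  qed
  moreover have "(1 - x) * (1 - (1 - y1) / (1 - y2)) \<le> (1 - x) * ln ((1 - y2) / (1 - y1))"
    using assms one_minus_inverse_le_ln[of "(1 - y2) / (1 - y1)"]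
    by (intro mult_left_mono) auto
  moreover have "x * (1 - y1 / y2) + (1 - x) * (1 - (1 - y1) / (1 - y2))
      = (y2 - y1) * (x - y2) / (y2 * (1 - y2))"
    using assms by (simp add: field_simps)
  moreover have "(y2 - y1) * (x - y2) / (y2 * (1 - y2)) \<ge> 0"
    using assms by (intro divide_nonneg_nonneg mult_nonneg_nonneg) auto
  ultimately show ?thesis by linarith
qed

text \<open>First-order expansion in the first argument around \<open>x1\<close>: the linear term
  carries the derivative there, nonnegative for \<open>y \<le> x1\<close>, and the remainder is
  exactly \<open>d_KL x2 x1\<close>.\<close>

lemma d_KL_strict_mono:
  assumes "0 < y" "y \<le> x1" "x1 < x2" "x2 < 1"
  shows "d_KL x1 y < d_KL x2 y"
proof -
  have "d_KL x2 y = d_KL x1 y + (x2 - x1) * (ln (x1 / y) + ln ((1 - y) / (1 - x1))) + d_KL x2 x1"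
    using assms by (simp add: d_KL_def ln_div algebra_simps)
  moreover have "(x2 - x1) * (ln (x1 / y) + ln ((1 - y) / (1 - x1))) \<ge> 0"
    using assms by (intro mult_nonneg_nonneg add_nonneg_nonneg ln_ge_zero) auto
  moreover have "d_KL x2 x1 > 0"
    using assms d_KL_strict_antimono[of x1 x2 x2] d_KL_refl[of x2] by auto
  ultimately show ?thesis by linarith
qed

text \<open>Makes the \<open>THE\<close> in the definition meaningful: existence by the intermediate
  value theorem on \<open>{y0..x}\<close>, uniqueness by strict antitonicity.\<close>

lemma disagreement_inv_props:
  assumes "\<eta> \<ge> 0" "0 < x" "x < 1"
  shows disagreement_inv_pos: "0 < disagreement_inv \<eta> x"
    and disagreement_inv_le: "disagreement_inv \<eta> x \<le> x"
    and d_KL_disagreement_inv: "d_KL x (disagreement_inv \<eta> x) = \<eta>"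
proof -
  \<comment> \<open>\<open>y0\<close> solves
    \<open>x * ln (x / y0) + (1 - x) * ln (1 - x) = \<eta>\<close>. The rest of
    \<open>d_KL x y0\<close> is \<open>- (1 - x) * ln (1 - y0) \<ge> 0\<close>, so the divergence at
    \<open>y0\<close> is at least \<eta>.\<close>
  define y0 where "y0 = x * exp (- ((\<eta> - (1 - x) * ln (1 - x)) / x))"
  have e: "(\<eta> - (1 - x) * ln (1 - x)) / x \<ge> 0"
    using assms mult_nonneg_nonpos[of "1 - x" "ln (1 - x)"] by (intro divide_nonneg_pos) auto
  have y0: "0 < y0" "y0 \<le> x"
    using assms e by (auto simp: y0_def mult_left_le)
  have "d_KL x y0 \<ge> \<eta>"
  proof -
    have "ln (x / y0) = (\<eta> - (1 - x) * ln (1 - x)) / x"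
      using assms by (simp add: y0_def ln_div ln_mult)
    then have "x * ln (x / y0) = \<eta> - (1 - x) * ln (1 - x)"
      using assms by simp
    moreover have "(1 - x) * ln ((1 - x) / (1 - y0)) = (1 - x) * ln (1 - x) - (1 - x) * ln (1 - y0)"
      using assms y0 by (simp add: ln_div algebra_simps)
    ultimately have "d_KL x y0 = \<eta> - (1 - x) * ln (1 - y0)"
      by (simp add: d_KL_def)
    moreover have "(1 - x) * ln (1 - y0) \<le> 0"
      using assms y0 by (intro mult_nonneg_nonpos) auto
    ultimately show ?thesis by linarith
  qed
  moreover have "d_KL x x \<le> \<eta>" using assms d_KL_refl by simp
  moreover have "continuous_on {y0..x} (d_KL x)"
    unfolding d_KL_def using assms y0 by (intro continuous_intros) auto
  ultimately obtain y where y: "y0 \<le> y" "y \<le> x" "d_KL x y = \<eta>"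
    using IVT2'[of "d_KL x" x \<eta> y0] y0 by auto
  have "\<exists>!y. 0 < y \<and> y \<le> x \<and> d_KL x y = \<eta>"
  proof (rule ex1I[of _ y])
    fix z assume z: "0 < z \<and> z \<le> x \<and> d_KL x z = \<eta>"
    show "z = y"
      using z y y0 assms d_KL_strict_antimono[of z y x] d_KL_strict_antimono[of y z x]
      by (cases z y rule: linorder_cases) auto
  qed (use y y0 in auto)
  from theI'[OF this] show "0 < disagreement_inv \<eta> x" "disagreement_inv \<eta> x \<le> x"
    "d_KL x (disagreement_inv \<eta> x) = \<eta>"
    using assms by (auto simp: disagreement_inv_def)
qed

text \<open>Inverses in the wrong order would give
  \<open>d_KL x2 ?y1 \<le> d_KL x2 ?y2 = \<eta> = d_KL x1 ?y1\<close>, against strict growth in the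
  first argument.\<close>

lemma disagreement_inv_strict_mono:
  assumes "\<eta> \<ge> 0" "0 < x1" "x1 < x2" "x2 < 1"
  shows "disagreement_inv \<eta> x1 < disagreement_inv \<eta> x2"
proof (rule ccontr)
  let ?y1 = "disagreement_inv \<eta> x1" and ?y2 = "disagreement_inv \<eta> x2"
  note p1 = disagreement_inv_props[of \<eta> x1] and p2 = disagreement_inv_props[of \<eta> x2]
  assume "\<not> ?y1 < ?y2"
  then have "d_KL x2 ?y1 \<le> d_KL x2 ?y2"
    using assms p1 p2 d_KL_strict_antimono[of ?y2 ?y1 x2] by (cases "?y1 = ?y2") auto
  then show False
    using assms p1 p2 d_KL_strict_mono[of ?y1 x1 x2] by auto
qed

text \<open>Above the inverse the divergence constraint is slack at \<open>x\<close>; continuity in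
  the first argument leaves room for a mass \<open>h\<close> slightly larger than
  \<open>x\<close>.\<close>

lemma d_KL_less_right_nbhd:
  assumes "\<eta> \<ge> 0" "0 < x" "x < 1" "disagreement_inv \<eta> x < y" "y \<le> x"
  shows "\<exists>h. x < h \<and> h < 1 \<and> d_KL h y < \<eta>"
proof -
  note p = disagreement_inv_props[OF assms(1-3)]
  have "d_KL x y < \<eta>"
    using d_KL_strict_antimono[of "disagreement_inv \<eta> x" y x] assms p by auto
  moreover have "isCont (\<lambda>h. d_KL h y) x"
    unfolding d_KL_def using assms p by (intro continuous_intros) auto
  ultimately have "\<forall>\<^sub>F h in at x. d_KL h y < \<eta>"
    using order_tendstoD(2) unfolding isCont_def by blast
  then have "\<forall>\<^sub>F h in at_right x. d_KL h y < \<eta>"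
    by (simp add: eventually_at_split)
  then obtain b where b: "b > x" "\<forall>h. x < h \<longrightarrow> h < b \<longrightarrow> d_KL h y < \<eta>"
    by (auto simp: eventually_at_right_field)
  obtain h where "x < h" "h < min b 1" using dense[of x "min b 1"] b(1) assms by auto
  then show ?thesis using b by auto
qed

text \<open>Right continuity in \<open>x\<close> makes \<open>p \<mapsto> I (1 / p)\<close>
  left-continuous, as the tail \<open>P (Y \<ge> p)\<close> of a law has to be.\<close>

lemma disagreement_inv_right_cont:
  assumes "\<eta> \<ge> 0" "0 < x" "x < 1" "disagreement_inv \<eta> x < u"
  shows "\<exists>x'. x < x' \<and> x' < 1 \<and> disagreement_inv \<eta> x' < u"
proof (cases "u \<le> x")
  case True
  from d_KL_less_right_nbhd[OF assms True] obtain h where h: "x < h" "h < 1" "d_KL h u < \<eta>"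
    by blast
  note p = disagreement_inv_props[of \<eta> h] and q = disagreement_inv_props[OF assms(1-3)]
  have "disagreement_inv \<eta> h < u"
  proof (rule ccontr)
    assume "\<not> ?thesis"
    then have "d_KL h (disagreement_inv \<eta> h) \<le> d_KL h u"
      using d_KL_strict_antimono[of u "disagreement_inv \<eta> h" h] p q h assms
      by (cases "u = disagreement_inv \<eta> h") auto
    then show False using p h assms by auto
  qed
  with h show ?thesis by blast
next
  case False
  obtain x' where "x < x'" "x' < min u 1" using dense[of x "min u 1"] False assms by auto
  then show ?thesis using disagreement_inv_le[of \<eta> x'] assms by fastforce
qed

section \<open>Distributions on the unit interval\<close>

lemma unit_distribution_real_distribution: "unit_distribution G \<Longrightarrow> real_distribution G"
  by (simp add: unit_distribution_def)

lemma unit_distribution_AE: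
  assumes "unit_distribution G"
  shows "AE s in G. s \<in> {0..1}"
proof -
  interpret real_distribution G using assms by (rule unit_distribution_real_distribution)
  show ?thesis using assms prob_eq_1[of "{0..1}"] by (simp add: unit_distribution_def)
qed

lemma unit_distributionI:
  assumes "prob_space H" "sets H = sets borel" "AE s in H. s \<in> {0..1}"
  shows "unit_distribution H"
proof -
  interpret prob_space H by fact
  have [simp]: "space H = UNIV" using assms(2) sets_eq_imp_space_eq by fastforce
  have "real_distribution H"
    by (rule real_distribution.intro) (auto simp: assms real_distribution_axioms_def)
  moreover have "prob {0..1} = 1" using assms(2,3) prob_eq_1[of "{0..1::real}"] by simp
  ultimately show ?thesis by (simp add: unit_distribution_def)
qed

lemma unit_distribution_tail_eq_0:
  assumes "unit_distribution H" "p > 1"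
  shows "measure H {p..} = 0"
proof -
  interpret real_distribution H using assms(1) by (rule unit_distribution_real_distribution)
  show ?thesis using unit_distribution_AE[OF assms(1)] assms(2) by (auto intro!: prob_eq_0[THEN iffD2])
qed

lemma (in real_distribution) tail_antimono: "p \<le> q \<Longrightarrow> measure M {q..} \<le> measure M {p..}"
  by (intro finite_measure_mono) auto

lemma (in real_distribution) integrable_clip:
  assumes "f \<in> borel_measurable borel" "\<And>s. \<bar>f s\<bar> \<le> (B::real)"
  shows "integrable M f"
  using assms by (intro integrable_const_bound[of f B]) auto

lemma unit_distribution_integrable:
  fixes f :: "real \<Rightarrow> real"
  assumes "unit_distribution G" "f \<in> borel_measurable borel" "\<And>s. s \<in> {0..1} \<Longrightarrow> \<bar>f s\<bar> \<le> B"
  shows "integrable G f"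
proof -
  interpret real_distribution G using assms(1) by (rule unit_distribution_real_distribution)
  show ?thesis using unit_distribution_AE[OF assms(1)] assms(2,3)
    by (intro integrable_const_bound[of f B]) auto
qed

section \<open>The seller's price\<close>

text \<open>Upper semicontinuity of revenue: eventually \<open>p n\<close> exceeds
  \<open>q - 1 / Suc k\<close>, so its tail is at most the tail there, and continuity from above
  handles the limit in \<open>k\<close>.\<close>

lemma (in real_distribution) revenue_limit:
  assumes "p \<longlonglongrightarrow> q" "\<And>n. 0 \<le> p n" "(\<lambda>n. p n * measure M {p n..}) \<longlonglongrightarrow> S"
  shows "S \<le> q * measure M {q..}"
proof -
  have q: "q \<ge> 0" using assms(1,2) by (intro LIMSEQ_le_const[OF assms(1)]) auto
  have *: "S \<le> q * measure M {q - 1 / real (Suc k)..}" for k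
  proof (rule LIMSEQ_le[OF assms(3)])
    show "(\<lambda>n. p n * measure M {q - 1 / real (Suc k)..}) \<longlonglongrightarrow> q * measure M {q - 1 / real (Suc k)..}"
      by (intro tendsto_intros assms)
    have "\<forall>\<^sub>F n in sequentially. q - 1 / real (Suc k) < p n"
      by (rule order_tendstoD(1)[OF assms(1)]) simp
    then show "\<exists>N. \<forall>n\<ge>N. p n * measure M {p n..} \<le> p n * measure M {q - 1 / real (Suc k)..}"
      unfolding eventually_sequentially using assms(2)
      by (meson less_imp_le mult_left_mono tail_antimono)
  qed
  have "(\<lambda>k. measure M {q - 1 / real (Suc k)..}) \<longlonglongrightarrow> measure M (\<Inter>k. {q - 1 / real (Suc k)..})"
    by (rule finite_Lim_measure_decseq) (auto simp: decseq_def frac_le intro: order_trans[rotated])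
  also have "(\<Inter>k. {q - 1 / real (Suc k)..}) = {q..}"
  proof (intro equalityI subsetI)
    fix t assume "t \<in> (\<Inter>k. {q - 1 / real (Suc k)..})"
    then have "q - t \<le> 1 / real (Suc k)" for k by (auto simp: algebra_simps dest: spec[of _ k])
    then have "\<not> q - t > 0"
      using reals_Archimedean[of "q - t"] by (auto simp: inverse_eq_divide not_less[symmetric])
    then show "t \<in> {q..}" by simp
  qed (auto intro: order_trans[rotated])
  finally have "(\<lambda>k. q * measure M {q - 1 / real (Suc k)..}) \<longlonglongrightarrow> q * measure M {q..}"
    by (intro tendsto_intros)
  then show ?thesis using * by (intro LIMSEQ_le_const) auto
qed

text \<open>The \<open>LEAST\<close> needs a least maximiser. Compactness and semicontinuity give a
  maximiser \<open>q\<close>; the same limit argument, along maximisers approaching their infimum,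
  shows that the infimum is one too.\<close>

lemma seller_price_props:
  assumes "unit_distribution H"
  shows seller_price_range: "seller_price H \<in> {0..1}"
    and seller_price_optimal:
      "\<And>p. p \<in> {0..1} \<Longrightarrow> p * measure H {p..} \<le> seller_price H * measure H {seller_price H..}"
proof -
  interpret real_distribution H using assms by (rule unit_distribution_real_distribution)
  define f where "f p = p * measure H {p..}" for p
  define S where "S = (SUP p\<in>{0..1}. f p)"
  have bdd: "bdd_above (f ` {0..1})"
    by (intro bdd_aboveI2[of _ _ 1]) (auto simp: f_def intro: mult_le_one)
  have fS: "f p \<le> S" if "p \<in> {0..1}" for p
    unfolding S_def using that bdd by (rule cSUP_upper)
  have lim: "S \<le> f q" if "p \<longlonglongrightarrow> q" "\<And>n. p n \<in> {0..1}" "(\<lambda>n. f (p n)) \<longlonglongrightarrow> S" for p q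
    using revenue_limit[of p q S] that by (auto simp: f_def)
  have "\<exists>p. p \<in> {0..1} \<and> S - 1 / real (Suc n) < f p" for n
    using less_cSUP_iff[OF _ bdd, of "S - 1 / real (Suc n)"] by (auto simp: S_def[symmetric])
  then obtain p where p: "\<And>n. p n \<in> {0..1}" "\<And>n. S - 1 / real (Suc n) < f (p n)" by metis
  obtain q l where l: "strict_mono (l :: nat \<Rightarrow> nat)" "(p \<circ> l) \<longlonglongrightarrow> q"
    using compact_Icc[of 0 "1::real"] p(1) unfolding compact_def by metis
  have "(\<lambda>n. f (p n)) \<longlonglongrightarrow> S"
  proof (rule tendsto_sandwich[of "\<lambda>n. S - 1 / real (Suc n)" _ _ "\<lambda>n. S"])
    have "(\<lambda>n. S - 1 / real (Suc n)) \<longlonglongrightarrow> S - 0"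
      using LIMSEQ_inverse_real_of_nat by (intro tendsto_intros) (simp add: inverse_eq_divide)
    then show "(\<lambda>n. S - 1 / real (Suc n)) \<longlonglongrightarrow> S" by simp
  qed (use p fS in \<open>auto intro!: always_eventually less_imp_le\<close>)
  then have "S \<le> f q"
    using lim[OF l(2)] p(1) LIMSEQ_subseq_LIMSEQ[OF _ l(1)] by (auto simp: o_def)
  have "q \<in> {0..1}"
    using closed_sequentially[OF closed_atLeastAtMost, of "p \<circ> l" 0 1 q] l(2) p(1) by auto
  define A where "A = {p \<in> {0..1}. f p = S}"
  have "q \<in> A" using \<open>q \<in> {0..1}\<close> \<open>S \<le> f q\<close> fS[of q] by (auto simp: A_def)
  have bddA: "bdd_below A" by (auto simp: A_def intro: bdd_belowI[of _ 0])
  have "\<exists>a. a \<in> A \<and> a < Inf A + 1 / real (Suc n)" for n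
    using cInf_less_iff[of A "Inf A + 1 / real (Suc n)"] bddA \<open>q \<in> A\<close> by auto
  then obtain a where a: "\<And>n. a n \<in> A" "\<And>n. a n < Inf A + 1 / real (Suc n)" by metis
  have aInf: "a \<longlonglongrightarrow> Inf A"
  proof (rule tendsto_sandwich[of "\<lambda>n. Inf A" _ _ "\<lambda>n. Inf A + 1 / real (Suc n)"])
    have "(\<lambda>n. Inf A + 1 / real (Suc n)) \<longlonglongrightarrow> Inf A + 0"
      using LIMSEQ_inverse_real_of_nat by (intro tendsto_intros) (simp add: inverse_eq_divide)
    then show "(\<lambda>n. Inf A + 1 / real (Suc n)) \<longlonglongrightarrow> Inf A" by simp
  qed (use a bddA in \<open>auto intro!: always_eventually cInf_lower intro: less_imp_le\<close>)
  have "S \<le> f (Inf A)"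
    using lim[OF aInf] a(1) by (auto simp: A_def)
  moreover have "Inf A \<in> {0..1}"
    using closed_sequentially[OF closed_atLeastAtMost, of a 0 1 "Inf A"] aInf a(1)
    by (auto simp: A_def)
  ultimately have InfA: "Inf A \<in> A" using fS[of "Inf A"] by (auto simp: A_def)
  have *: "is_arg_max f (\<lambda>p. p \<in> {0..1}) x \<longleftrightarrow> x \<in> A" for x
    using fS \<open>q \<in> A\<close> by (fastforce simp: is_arg_max_def A_def)
  have "seller_price H = Inf A"
    unfolding seller_price_def f_def[symmetric] *
    by (rule Least_equality) (use InfA bddA in \<open>auto intro: cInf_lower\<close>)
  with InfA have A: "seller_price H \<in> A" by simp
  then show "seller_price H \<in> {0..1}" by (simp add: A_def)
  show "p * measure H {p..} \<le> seller_price H * measure H {seller_price H..}" if "p \<in> {0..1}" for p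
    using A fS[OF that] by (simp add: A_def f_def)
qed

text \<open>A price \<open>y\<close> earns at most \<open>y\<close>, so no price below
  \<open>r\<close> can match the revenue \<open>r\<close> of a sure sale.\<close>

lemma seller_price_eqI:
  assumes "r \<in> {0..1}" "measure H {r..} = 1"
    and "\<And>p. p \<in> {0..1} \<Longrightarrow> p * measure H {p..} \<le> r"
    and "unit_distribution H"
  shows "seller_price H = r"
proof -
  interpret real_distribution H using assms(4) by (rule unit_distribution_real_distribution)
  have "r \<le> y" if y: "y \<in> {0..1}" "\<not> y * measure H {y..} < r * measure H {r..}" for y
    using y assms(2) mult_left_mono[of "measure H {y..}" 1 y] by auto
  then show ?thesis unfolding seller_price_def
    using assms by (intro Least_equality) (auto simp: is_arg_max_def not_less)
qed

section \<open>Seller beliefs\<close>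

text \<open>Boundedness of \<open>f\<close> makes \<open>f * ln f\<close> integrable, so
  \<open>D_KL\<close> is finite and equals its integral; the Radon-Nikodym derivative is
  \<open>f\<close> by uniqueness of densities.\<close>

lemma density_admissible:
  assumes "unit_distribution G" "f \<in> borel_measurable borel"
    and "\<And>s. 0 \<le> f s" "\<And>s. f s \<le> K" "(LINT s|G. f s) = 1"
    and "(LINT s|G. f s * ln (f s)) \<le> \<eta>"
  shows "admissible \<eta> G (density G f)"
proof -
  interpret real_distribution G using assms(1) by (rule unit_distribution_real_distribution)
  let ?H = "density G f"
  note [measurable] = assms(2)
  have f: "integrable G f"
    using assms(3,4) by (intro integrable_clip[of f K]) auto
  have "prob_space ?H"
    by (rule prob_spaceI)
       (use assms(3,5) f in \<open>simp add: emeasure_density nn_integral_eq_integral cong: nn_integral_cong\<close>)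
  moreover have "AE s in ?H. s \<in> {0..1}"
    using unit_distribution_AE[OF assms(1)] by (subst AE_density) auto
  ultimately have "unit_distribution ?H"
    by (intro unit_distributionI) auto
  have b: "\<bar>t * ln t\<bar> \<le> 1 + K * K" if "0 \<le> t" "t \<le> K" for t :: real
  proof (cases "t \<ge> 1")
    case True
    then have "ln t \<le> t" using ln_le_minus_one[of t] by linarith
    then have "t * ln t \<le> K * K" using True that by (intro mult_mono) auto
    then show ?thesis using True by auto
  next
    case False
    show ?thesis
    proof (cases "t = 0")
      case False
      then have "t * (1 - 1 / t) \<le> t * ln t"
        using that one_minus_inverse_le_ln[of t] by (intro mult_left_mono) auto
      moreover have "t * (1 - 1 / t) = t - 1" using False by (simp add: right_diff_distrib)
      ultimately have "t - 1 \<le> t * ln t" by simp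
      moreover have "t * ln t \<le> 0" using that False \<open>\<not> 1 \<le> t\<close> by (intro mult_nonneg_nonpos) auto
      ultimately show ?thesis using that by (auto simp: abs_if) (smt (verit) zero_le_square)
    qed simp
  qed
  have fl: "integrable G (\<lambda>s. f s * ln (f s))"
    using b assms(3,4) by (intro integrable_clip[of _ "1 + K * K"]) auto
  have l: "log (exp 1) = ln" by (auto simp: log_def)
  have ac: "absolutely_continuous G ?H" by (rule absolutely_continuousI_density) simp
  have "density G (RN_deriv G ?H) = ?H"
    by (rule density_RN_deriv_density) auto
  then have eq: "AE s in G. RN_deriv G ?H s = f s"
    by (intro density_unique) auto
  have "integrable ?H (entropy_density (exp 1) G ?H)"
  proof (subst integrable_density)
    show "integrable G (\<lambda>s. f s *\<^sub>R entropy_density (exp 1) G ?H s)"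
      by (rule integrable_cong_AE_imp[OF fl])
         (use eq assms(3) in \<open>auto simp: entropy_density_def l\<close>)
  qed (use assms(3) in auto)
  moreover have "KL_divergence (exp 1) G ?H = (LINT s|G. f s * ln (f s))"
    using KL_density[of "exp 1" f] assms(3) by (simp add: l)
  ultimately show ?thesis
    using ac assms(6) \<open>unit_distribution ?H\<close> by (simp add: admissible_def D_KL_def)
qed

lemma admissible_self:
  assumes "\<eta> \<ge> 0" "unit_distribution G"
  shows "admissible \<eta> G G"
proof -
  interpret real_distribution G using assms(2) by (rule unit_distribution_real_distribution)
  have "density G (\<lambda>_. ennreal 1) = G" by (simp add: density_1)
  moreover have "admissible \<eta> G (density G (\<lambda>_. ennreal 1))"
    using assms prob_space by (intro density_admissible[of _ _ 1]) (auto simp del: ennreal_1)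
  ultimately show ?thesis by simp
qed

text \<open>The exponential tilt of \<open>G\<close> at \<open>p\<close>: the cheapest way to give \<open>{p..}\<close> mass \<open>h\<close>.\<close>

lemma tilt_admissible:
  assumes "unit_distribution G" and y: "0 < y" "y < 1" "y = measure G {p..}"
    and h: "0 < h" "h < 1" "d_KL h y \<le> \<eta>"
  obtains H where "admissible \<eta> G H"
    and "\<And>q. q \<le> p \<Longrightarrow> measure H {q..} = 1 - (1 - h) / (1 - y) * (1 - measure G {q..})"
proof -
  interpret real_distribution G using assms(1) by (rule unit_distribution_real_distribution)
  define f where "f s = (if s \<ge> p then h / y else (1 - h) / (1 - y))" for s
  have [measurable]: "f \<in> borel_measurable borel" unfolding f_def by measurable
  have int: "(LINT s|G. (if s \<ge> p then a else b)) = a * y + b * (1 - y)" for a b :: real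
  proof -
    have "(LINT s|G. (if s \<ge> p then a else b)) = (LINT s|G. b + (a - b) * indicator {p..} s)"
      by (intro Bochner_Integration.integral_cong) (auto simp: indicator_def)
    also have "\<dots> = b + (a - b) * y" using y(3) prob_space by (simp add: emeasure_eq_measure)
    finally show ?thesis by (simp add: algebra_simps)
  qed
  have f1: "(LINT s|G. f s) = 1"
    unfolding f_def int using y by simp
  have nn: "0 \<le> f s" for s using y h by (auto simp: f_def)
  have le: "f s \<le> h / y + (1 - h) / (1 - y)" for s using y h by (auto simp: f_def)
  have "(LINT s|G. f s * ln (f s)) = (LINT s|G. (if s \<ge> p then h / y * ln (h / y)
      else (1 - h) / (1 - y) * ln ((1 - h) / (1 - y))))"
    by (intro Bochner_Integration.integral_cong) (auto simp: f_def)
  \<comment> \<open>A density with only two values turns the relative entropy into the binary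
    divergence.\<close>
  also have "\<dots> = d_KL h y" unfolding int d_KL_def using y by simp
  finally have adm: "admissible \<eta> G (density G f)"
    using h by (intro density_admissible[OF assms(1) _ nn le f1]) auto
  interpret H: real_distribution "density G f"
    using adm by (auto simp: admissible_def unit_distribution_def)
  have "measure (density G f) {q..} = 1 - (1 - h) / (1 - y) * (1 - measure G {q..})" if "q \<le> p" for q
  proof -
    let ?c = "(1 - h) / (1 - y)"
    have "emeasure (density G f) {..<q} = (\<integral>\<^sup>+ s. ennreal (f s) * indicator {..<q} s \<partial>G)"
      by (simp add: emeasure_density)
    also have "\<dots> = (\<integral>\<^sup>+ s. ennreal ?c * indicator {..<q} s \<partial>G)"
      using that by (intro nn_integral_cong) (auto simp: f_def indicator_def)
    also have "\<dots> = ennreal ?c * emeasure G {..<q}" by (simp add: nn_integral_cmult_indicator)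
    finally have "measure (density G f) {..<q} = ?c * measure G {..<q}"
      using h y by (simp add: measure_def enn2real_mult)
    moreover have "measure G {..<q} = 1 - measure G {q..}"
      using prob_compl[of "{q..}"] by (simp add: Compl_eq_Diff_UNIV[symmetric])
    moreover have "measure (density G f) {q..} = 1 - measure (density G f) {..<q}"
      using H.prob_compl[of "{..<q}"] by (simp add: Compl_eq_Diff_UNIV[symmetric])
    ultimately show ?thesis by simp
  qed
  with adm show ?thesis by (rule that)
qed

text \<open>The Donsker--Varadhan bound for the test function taking the values \<open>ln (x / y)\<close> on \<open>A\<close>
  and \<open>ln ((1 - x) / (1 - y))\<close> off \<open>A\<close>, whose exponential has \<open>G\<close>-mean 1.\<close>

lemma admissible_two_point_bound:
  assumes "admissible \<eta> G H" "unit_distribution G" and A: "A \<in> sets borel"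
    and y: "y = measure G A" "0 < y" "y < 1" and x: "0 < x" "x < 1"
  shows "measure H A * ln (x / y) + (1 - measure H A) * ln ((1 - x) / (1 - y)) \<le> \<eta>"
proof -
  interpret G: real_distribution G using assms(2) by (rule unit_distribution_real_distribution)
  interpret H: real_distribution H using assms(1) by (auto simp: admissible_def unit_distribution_def)
  have ac: "absolutely_continuous G H" and ie: "integrable H (entropy_density (exp 1) G H)"
    and KL: "KL_divergence (exp 1) G H \<le> \<eta>"
    using assms(1) by (auto simp: admissible_def D_KL_def split: if_splits)
  obtain D where D: "D \<in> borel_measurable G" "AE s in G. RN_deriv G H s = ennreal (D s)"
    "AE s in H. 0 < D s" "\<And>s. 0 \<le> D s"
    using G.real_RN_deriv[of H] ac H.finite_measure_axioms by auto
  note [measurable] = D(1) A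
  have HD: "H = density G D"
    using G.density_RN_deriv[OF ac] density_cong[OF _ _ D(2)] by simp
  define w where "w s = (if s \<in> A then x / y else (1 - x) / (1 - y))" for s
  have [measurable]: "w \<in> borel_measurable borel" unfolding w_def by measurable
  have wpos: "w s > 0" for s using x y by (auto simp: w_def)
  have wle: "w s \<le> x / y + (1 - x) / (1 - y)" for s using x y by (auto simp: w_def)
  have wi: "w s = (1 - x) / (1 - y) + (x / y - (1 - x) / (1 - y)) * indicator A s" for s
    by (simp add: w_def indicator_def)
  have w1: "(LINT s|G. w s) = 1"
  proof -
    have "(LINT s|G. w s) = (1 - x) / (1 - y) + (x / y - (1 - x) / (1 - y)) * y"
      unfolding wi using y(1) G.prob_space by (simp add: G.emeasure_eq_measure)
    also have "\<dots> = (x / y) * y + (1 - x) / (1 - y) * (1 - y)" by (simp only: algebra_simps)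
    finally show ?thesis using y by simp
  qed
  have wint: "integrable G w" using wpos wle by (intro G.integrable_clip) (auto simp: less_imp_le)
  \<comment> \<open>Where \<open>D s = 0\<close> the quotient \<open>w s / D s\<close> is 0 by
    convention, so \<open>D s * (w s / D s)\<close> is only bounded by \<open>w s\<close>; this
    suffices for the mean under \<open>H\<close> to be at most 1.\<close>
  have DwD: "integrable G (\<lambda>s. D s * (w s / D s))"
    by (rule Bochner_Integration.integrable_bound[OF wint]) (use D(4) wpos in \<open>auto simp: less_imp_le\<close>)
  have wD: "integrable H (\<lambda>s. w s / D s)"
    unfolding HD using DwD D(4) by (subst integrable_density) auto
  have "(LINT s|H. w s / D s) = (LINT s|G. D s * (w s / D s))"
    unfolding HD using D(4) by (subst integral_density) auto
  also have "\<dots> \<le> (LINT s|G. w s)"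
    by (rule integral_mono[OF DwD wint]) (use wpos in \<open>auto simp: less_imp_le\<close>)
  finally have wD1: "(LINT s|H. w s / D s) \<le> 1" using w1 by simp
  have lw: "ln (w s) = ln ((1 - x) / (1 - y)) + (ln (x / y) - ln ((1 - x) / (1 - y))) * indicator A s" for s
    by (simp add: w_def indicator_def)
  have lwint: "integrable H (\<lambda>s. ln (w s))"
    unfolding lw by (simp add: H.emeasure_eq_measure)
  have "AE s in H. RN_deriv G H s = ennreal (D s)"
    by (rule absolutely_continuous_AE[OF _ ac D(2)]) simp
  with D(3) have ed: "AE s in H. ln (w s) \<le> entropy_density (exp 1) G H s + (w s / D s - 1)"
  proof eventually_elim
    case (elim s)
    then have "entropy_density (exp 1) G H s = ln (D s)" by (simp add: entropy_density_def log_def)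
    moreover have "ln (w s / D s) \<le> w s / D s - 1" using elim wpos by (intro ln_le_minus_one) auto
    ultimately show ?case using elim wpos[of s] by (simp add: ln_div)
  qed
  have "(LINT s|H. ln (w s)) \<le> (LINT s|H. entropy_density (exp 1) G H s + (w s / D s - 1))"
    by (rule integral_mono_AE[OF lwint _ ed]) (use ie wD in auto)
  also have "\<dots> = KL_divergence (exp 1) G H + ((LINT s|H. w s / D s) - 1)"
    using ie wD H.prob_space by (simp add: KL_divergence_def)
  finally have "(LINT s|H. ln (w s)) \<le> \<eta>" using KL wD1 by linarith
  moreover have "(LINT s|H. ln (w s)) = measure H A * ln (x / y) + (1 - measure H A) * ln ((1 - x) / (1 - y))"
    unfolding lw using H.prob_space by (simp add: H.emeasure_eq_measure algebra_simps)
  ultimately show ?thesis by simp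
qed

text \<open>Finite divergence includes absolute continuity. This covers the events of
  \<open>G\<close>-mass 0, where the two-point bound does not apply.\<close>

lemma admissible_null:
  assumes "admissible \<eta> G H" "unit_distribution G" "A \<in> sets borel" "measure G A = 0"
  shows "measure H A = 0"
proof -
  interpret G: real_distribution G using assms(2) by (rule unit_distribution_real_distribution)
  have "absolutely_continuous G H"
    using assms(1) by (auto simp: admissible_def D_KL_def split: if_splits)
  moreover have "A \<in> null_sets G" using assms(3,4) by (auto simp: G.emeasure_eq_measure)
  ultimately have "A \<in> null_sets H" by (auto simp: absolutely_continuous_def)
  then show ?thesis by (simp add: measure_def null_setsD1)
qed

section \<open>Truncated means\<close>

text \<open>The function \<rho> of the overview. For nonnegative laws it is the tail integrated over
  \<open>{0..x}\<close>, and it makes sense for the unbounded law of \<open>r * Y\<close> as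
  well.\<close>

definition mean_min :: "real measure \<Rightarrow> real \<Rightarrow> real" where
  "mean_min G x = (LINT s|G. min s x)"

context real_distribution
begin

text \<open>Tonelli: both sides are the product measure of \<open>A\<close>.\<close>

lemma emeasure_sections:
  assumes "A \<in> sets (borel \<Otimes>\<^sub>M borel)"
  shows "(\<integral>\<^sup>+ t. emeasure M {s. (s, t) \<in> A} \<partial>lborel) = (\<integral>\<^sup>+ s. emeasure lborel {t. (s, t) \<in> A} \<partial>M)"
proof -
  interpret P: pair_sigma_finite M lborel ..
  have A: "A \<in> sets (M \<Otimes>\<^sub>M lborel)"
    using assms by (simp cong: sets_pair_measure_cong)
  show ?thesis
    using P.emeasure_pair_measure_alt2[OF A] lborel.emeasure_pair_measure_alt[OF A]
    by (simp add: vimage_def)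
qed

text \<open>Layer-cake formula on the window \<open>{a<..x}\<close>: the levels \<open>t\<close> of
  the window with \<open>t \<le> s\<close> form the interval from \<open>a\<close> to
  \<open>min (max s a) x\<close>.\<close>

lemma nn_integral_tail:
  assumes "a \<le> x"
  shows "(\<integral>\<^sup>+ t. emeasure M {t..} * indicator {a<..x} t \<partial>lborel)
    = ennreal (LINT s|M. min (max s a) x - a)"
proof -
  let ?A = "{z \<in> space (borel \<Otimes>\<^sub>M borel). a < snd z \<and> snd z \<le> x \<and> snd z \<le> (fst z :: real)}"
  have "(\<integral>\<^sup>+ t. emeasure M {t..} * indicator {a<..x} t \<partial>lborel)
    = (\<integral>\<^sup>+ t. emeasure M {s. (s, t) \<in> ?A} \<partial>lborel)"
    by (intro nn_integral_cong) (auto simp: indicator_def space_pair_measure atLeast_def)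
  also have "\<dots> = (\<integral>\<^sup>+ s. emeasure lborel {t. (s, t) \<in> ?A} \<partial>M)"
    by (intro emeasure_sections) measurable
  also have "\<dots> = (\<integral>\<^sup>+ s. ennreal (min (max s a) x - a) \<partial>M)"
  proof (intro nn_integral_cong)
    fix s
    have "{t. (s, t) \<in> ?A} = {a<..min (max s a) x}"
      using assms by (auto simp: space_pair_measure)
    then show "emeasure lborel {t. (s, t) \<in> ?A} = ennreal (min (max s a) x - a)"
      using assms by simp
  qed
  also have "\<dots> = ennreal (LINT s|M. min (max s a) x - a)"
    using assms by (intro nn_integral_eq_integral integrable_clip[of _ "x - a"]) auto
  finally show ?thesis .
qed

lemma integrable_scaled_tail: "integrable M (\<lambda>s. (c::real) * indicator {q..} s)"
  by (intro integrable_clip[of _ "\<bar>c\<bar>"]) (auto simp: indicator_def)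

lemma integrable_clamp: "integrable M (\<lambda>s. min (max s a) x)"
  by (intro integrable_clip[of _ "\<bar>a\<bar> + \<bar>x\<bar>"]) auto

end

text \<open>Clamping to \<open>{a..x}\<close> makes the mean depend only on the tails inside the
  window, so domination there is enough.\<close>

lemma clamped_mean_mono_tail:
  assumes "real_distribution M" "real_distribution N" "a \<le> x"
    and "\<And>t. a < t \<Longrightarrow> t \<le> x \<Longrightarrow> measure M {t..} \<le> measure N {t..}"
  shows "(LINT s|M. min (max s a) x) \<le> (LINT s|N. min (max s a) x)"
proof -
  interpret M: real_distribution M by fact
  interpret N: real_distribution N by fact
  have "ennreal (LINT s|M. min (max s a) x - a) \<le> ennreal (LINT s|N. min (max s a) x - a)"
    unfolding M.nn_integral_tail[OF assms(3), symmetric] N.nn_integral_tail[OF assms(3), symmetric]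
    using assms(4)
    by (intro nn_integral_mono) (auto simp: indicator_def M.emeasure_eq_measure N.emeasure_eq_measure)
  moreover have "0 \<le> (LINT s|N. min (max s a) x - a)"
    using assms(3) by (intro Bochner_Integration.integral_nonneg) auto
  ultimately show ?thesis
    using M.prob_space N.prob_space M.integrable_clamp N.integrable_clamp by simp
qed

section \<open>Truncated means of nonnegative laws\<close>

locale nonneg_distribution = real_distribution +
  assumes nonneg: "AE s in M. 0 \<le> s"
begin

lemma integrable_min: "0 \<le> x \<Longrightarrow> integrable M (\<lambda>s. min s x)"
  using nonneg by (intro integrable_const_bound[of _ x]) auto

lemma mean_min_le: "0 \<le> x \<Longrightarrow> mean_min M x \<le> x"
  using integral_mono[OF integrable_min, of x "\<lambda>_. x"] prob_space by (simp add: mean_min_def)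

lemma mean_min_mono: "0 \<le> x \<Longrightarrow> x \<le> y \<Longrightarrow> mean_min M x \<le> mean_min M y"
  unfolding mean_min_def by (intro integral_mono integrable_min) auto

lemma mean_min_Lipschitz:
  assumes "0 \<le> x" "x \<le> y"
  shows "mean_min M y \<le> mean_min M x + (y - x)"
proof -
  have "mean_min M y \<le> (LINT s|M. min s x + (y - x))"
    unfolding mean_min_def using assms by (intro integral_mono) (auto intro: integrable_min)
  also have "\<dots> = mean_min M x + (y - x)"
    using assms prob_space by (simp add: mean_min_def integrable_min)
  finally show ?thesis .
qed

lemma continuous_on_mean_min: "continuous_on {0..} (mean_min M)"
proof -
  have "1-lipschitz_on {0..} (mean_min M)"
  proof (rule lipschitz_onI)
    fix x y :: real assume "x \<in> {0..}" "y \<in> {0..}"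
    then show "dist (mean_min M x) (mean_min M y) \<le> 1 * dist x y"
      using mean_min_Lipschitz[of x y] mean_min_Lipschitz[of y x]
        mean_min_mono[of x y] mean_min_mono[of y x]
      by (cases "x \<le> y") (auto simp: dist_real_def)
  qed simp
  then show ?thesis by (rule lipschitz_on_continuous_on)
qed

text \<open>Markov's inequality for \<open>min s q\<close>; it bounds the revenue at price
  \<open>q\<close> by \<rho>.\<close>

lemma tail_le_mean_min:
  assumes "0 \<le> q"
  shows "q * measure M {q..} \<le> mean_min M q"
proof -
  have "(LINT s|M. q * indicator {q..} s) \<le> mean_min M q"
    unfolding mean_min_def
  proof (rule integral_mono_AE)
    show "AE s in M. q * indicator {q..} s \<le> min s q"
      using nonneg assms by (auto simp: indicator_def)
  qed (intro integrable_scaled_tail, rule integrable_min[OF assms])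
  then show ?thesis by (simp add: emeasure_eq_measure)
qed

end

section \<open>Bayes plausibility and surplus in terms of truncated means\<close>

lemma unit_distribution_nonneg_distribution:
  assumes "unit_distribution G"
  shows "nonneg_distribution G"
proof -
  interpret real_distribution G using assms by (rule unit_distribution_real_distribution)
  show ?thesis using unit_distribution_AE[OF assms] by unfold_locales auto
qed

lemma mean_min_1:
  assumes "unit_distribution G"
  shows "mean_min G 1 = (LINT s|G. s)"
proof -
  interpret real_distribution G using assms by (rule unit_distribution_real_distribution)
  show ?thesis unfolding mean_min_def
    using unit_distribution_AE[OF assms] by (intro integral_cong_AE) auto
qed

text \<open>By Tonelli the integrated cdf is the mean of the length of \<open>{s..x}\<close>, which
  is \<open>x - min s x\<close> for \<open>s \<ge> 0\<close>. Integrated-cdf inequalities thus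
  become reversed inequalities of \<rho>.\<close>

lemma integral_cdf:
  assumes "unit_distribution G" "0 \<le> x"
  shows "(LBINT s:{0..x}. cdf G s) = x - mean_min G x"
proof -
  interpret nonneg_distribution G using assms(1) by (rule unit_distribution_nonneg_distribution)
  let ?A = "{z \<in> space (borel \<Otimes>\<^sub>M borel). 0 \<le> snd z \<and> snd z \<le> x \<and> (fst z :: real) \<le> snd z}"
  have cdf_meas [measurable]: "cdf G \<in> borel_measurable borel"
    by (intro borel_measurable_mono) (auto simp: mono_def cdf_nondecreasing)
  have "(\<integral>\<^sup>+ t. ennreal (indicator {0..x} t * cdf G t) \<partial>lborel)
    = (\<integral>\<^sup>+ t. emeasure G {s. (s, t) \<in> ?A} \<partial>lborel)"
    by (intro nn_integral_cong)
      (auto simp: indicator_def space_pair_measure atMost_def cdf_def emeasure_eq_measure)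
  also have "\<dots> = (\<integral>\<^sup>+ s. emeasure lborel {t. (s, t) \<in> ?A} \<partial>G)"
    by (intro emeasure_sections) measurable
  also have "\<dots> = (\<integral>\<^sup>+ s. ennreal (x - min s x) \<partial>G)"
  proof (rule nn_integral_cong_AE)
    show "AE s in G. emeasure lborel {t. (s, t) \<in> ?A} = ennreal (x - min s x)"
      using nonneg
    proof eventually_elim
      case (elim s)
      then have "{t. (s, t) \<in> ?A} = (if s \<le> x then {s..x} else {})"
        by (auto simp: space_pair_measure)
      then show ?case by auto
    qed
  qed
  also have "\<dots> = ennreal (LINT s|G. x - min s x)"
    using assms(2) by (intro nn_integral_eq_integral) (auto simp: integrable_min)
  also have "(LINT s|G. x - min s x) = x - mean_min G x"
    using assms(2) prob_space by (simp add: mean_min_def integrable_min)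
  finally have "integral\<^sup>L lborel (\<lambda>t. indicator {0..x} t * cdf G t) = x - mean_min G x"
    using mean_min_le[OF assms(2)] cdf_nonneg
    by (intro integral_eq_nn_integral[THEN trans]) auto
  then show ?thesis by (simp add: set_lebesgue_integral_def)
qed

lemma bayes_plausible_iff:
  assumes "unit_distribution F"
  shows "bayes_plausible F G \<longleftrightarrow> unit_distribution G
    \<and> (\<forall>x\<in>{0..1}. mean_min F x \<le> mean_min G x) \<and> mean_min G 1 = mean_min F 1"
  using assms by (auto simp: bayes_plausible_def integral_cdf mean_min_1)

text \<open>On the unit interval the gain \<open>s - p\<close> on \<open>{p..1}\<close> is
  \<open>min s 1 - min s p\<close>.\<close>

lemma buyer_surplus_eq:
  assumes "unit_distribution G" "0 \<le> p" "p \<le> 1"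
  shows "buyer_surplus G p = mean_min G 1 - mean_min G p"
proof -
  interpret nonneg_distribution G using assms(1) by (rule unit_distribution_nonneg_distribution)
  have "buyer_surplus G p = (LINT s|G. min s 1 - min s p)"
    unfolding buyer_surplus_def set_lebesgue_integral_def
    using unit_distribution_AE[OF assms(1)] assms(2,3)
    by (intro integral_cong_AE) (auto simp: indicator_def)
  then show ?thesis using assms by (simp add: mean_min_def integrable_min)
qed

section \<open>The robust Pareto laws\<close>

text \<open>Generalised inverse of the tail \<open>y \<mapsto> I (1 / y)\<close>. The point 1 keeps
  the set nonempty and the values at least 1; outside the open unit interval 1 is a default.\<close>

definition pareto_quantile :: "real \<Rightarrow> real \<Rightarrow> real" where
  "pareto_quantile \<eta> u =
    (if 0 < u \<and> u < 1 then Sup {y. y = 1 \<or> 1 < y \<and> u \<le> disagreement_inv \<eta> (1 / y)} else 1)"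

lemma pareto_quantile_set_bdd:
  assumes "\<eta> \<ge> 0" "0 < u" "u < 1"
  shows "bdd_above {y. y = 1 \<or> 1 < y \<and> u \<le> disagreement_inv \<eta> (1 / y)}"
proof (rule bdd_aboveI[of _ "1 / u"])
  fix y assume "y \<in> {y. y = 1 \<or> 1 < y \<and> u \<le> disagreement_inv \<eta> (1 / y)}"
  then consider "y = 1" | "1 < y" "u \<le> disagreement_inv \<eta> (1 / y)" by auto
  then show "y \<le> 1 / u"
  proof cases
    case 2
    then have "u \<le> 1 / y" using disagreement_inv_le[of \<eta> "1 / y"] assms(1) by auto
    then show ?thesis using 2 assms by (simp add: field_simps)
  qed (use assms in simp)
qed

lemma pareto_quantile_ge_1:
  assumes "\<eta> \<ge> 0"
  shows "1 \<le> pareto_quantile \<eta> u"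
  using pareto_quantile_set_bdd[OF assms, of u] by (auto simp: pareto_quantile_def intro!: cSup_upper)

text \<open>The supremum is attained thanks to right continuity: if \<open>u\<close> exceeds
  \<open>I (1 / p)\<close>, it exceeds \<open>I x\<close> for some \<open>x > 1 / p\<close>, and no
  \<open>y > 1 / x\<close> belongs to the set, although \<open>1 / x < p\<close>.\<close>

lemma le_pareto_quantile_iff:
  assumes "\<eta> \<ge> 0" "0 < u" "u < 1" "1 < p"
  shows "p \<le> pareto_quantile \<eta> u \<longleftrightarrow> u \<le> disagreement_inv \<eta> (1 / p)"
proof
  assume "u \<le> disagreement_inv \<eta> (1 / p)"
  then show "p \<le> pareto_quantile \<eta> u"
    using pareto_quantile_set_bdd[OF assms(1-3)] assms
    by (auto simp: pareto_quantile_def intro!: cSup_upper)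
next
  let ?S = "{y. y = 1 \<or> 1 < y \<and> u \<le> disagreement_inv \<eta> (1 / y)}"
  assume p: "p \<le> pareto_quantile \<eta> u"
  show "u \<le> disagreement_inv \<eta> (1 / p)"
  proof (rule ccontr)
    assume "\<not> ?thesis"
    then obtain x where x: "1 / p < x" "x < 1" "disagreement_inv \<eta> x < u"
      using disagreement_inv_right_cont[of \<eta> "1 / p" u] assms by auto
    then have x0: "0 < x" using assms by (smt (verit) divide_pos_pos)
    have "1 / x < p" using x x0 assms by (simp add: field_simps)
    then have "1 / x < Sup ?S" using p assms by (simp add: pareto_quantile_def)
    then obtain y where y: "y \<in> ?S" "1 / x < y"
      using less_cSup_iff[OF _ pareto_quantile_set_bdd[OF assms(1-3)]] by blast
    have "1 < 1 / x" using x x0 by simp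
    then have "1 < y" "u \<le> disagreement_inv \<eta> (1 / y)" using y by auto
    moreover have "1 / y < x" using y x0 \<open>1 < y\<close> by (simp add: field_simps)
    ultimately show False
      using disagreement_inv_strict_mono[of \<eta> "1 / y" x] x assms(1) by auto
  qed
qed

lemma borel_measurable_pareto_quantile:
  assumes "\<eta> \<ge> 0"
  shows "pareto_quantile \<eta> \<in> borel_measurable borel"
  unfolding borel_measurable_iff_ge
proof
  fix p :: real
  have "{u. p \<le> pareto_quantile \<eta> u}
    = (if p \<le> 1 then UNIV else {0<..<1} \<inter> {..disagreement_inv \<eta> (1 / p)})"
  proof (cases "p \<le> 1")
    case True
    then show ?thesis using order_trans[OF True pareto_quantile_ge_1[OF assms]] by simp
  next
    case False
    have *: "p \<le> pareto_quantile \<eta> u \<longleftrightarrow> 0 < u \<and> u < 1 \<and> u \<le> disagreement_inv \<eta> (1 / p)" for u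
    proof (cases "0 < u \<and> u < 1")
      case True
      then show ?thesis using False le_pareto_quantile_iff[OF assms, of u p] by simp
    next
      case False
      then show ?thesis using \<open>\<not> p \<le> 1\<close> by (auto simp: pareto_quantile_def)
    qed
    show ?thesis unfolding * using False by auto
  qed
  then show "{w \<in> space borel. p \<le> pareto_quantile \<eta> w} \<in> sets borel" by simp
qed

text \<open>The law of \<open>Y\<close> in the overview, obtained by applying its upper quantile
  function to a uniform variable.\<close>

definition std_pareto :: "real \<Rightarrow> real measure" where
  "std_pareto \<eta> = distr (uniform_measure lborel {0<..<1}) borel (pareto_quantile \<eta>)"

lemma std_pareto:
  assumes "\<eta> \<ge> 0"
  shows real_distribution_std_pareto: "real_distribution (std_pareto \<eta>)"
    and std_pareto_AE: "AE y in std_pareto \<eta>. 1 \<le> y"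
    and std_pareto_tail: "1 < p \<Longrightarrow> measure (std_pareto \<eta>) {p..} = disagreement_inv \<eta> (1 / p)"
proof -
  let ?U = "uniform_measure lborel {0<..<1::real}"
  note [measurable] = borel_measurable_pareto_quantile[OF assms]
  interpret U: prob_space ?U by (rule prob_space_uniform_measure) auto
  interpret prob_space "std_pareto \<eta>" unfolding std_pareto_def by (rule U.prob_space_distr) simp
  show "real_distribution (std_pareto \<eta>)"
    by unfold_locales (auto simp: std_pareto_def)
  show "AE y in std_pareto \<eta>. 1 \<le> y"
    unfolding std_pareto_def using pareto_quantile_ge_1[OF assms] by (subst AE_distr_iff) auto
  assume p: "1 < p"
  have I: "0 < disagreement_inv \<eta> (1 / p)" "disagreement_inv \<eta> (1 / p) < 1"
    using disagreement_inv_pos[of \<eta> "1 / p"] disagreement_inv_le[of \<eta> "1 / p"] assms p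
    by (auto intro: le_less_trans)
  have "measure (std_pareto \<eta>) {p..} = measure ?U (pareto_quantile \<eta> -` {p..})"
    unfolding std_pareto_def by (subst measure_distr) auto
  also have "\<dots> = measure lborel ({0<..<1} \<inter> (pareto_quantile \<eta> -` {p..}))"
    using measurable_sets[OF borel_measurable_pareto_quantile[OF assms], of "{p..}"]
    by (subst measure_uniform_measure) auto
  also have "{0<..<1} \<inter> (pareto_quantile \<eta> -` {p..}) = {0<..disagreement_inv \<eta> (1 / p)}"
    using le_pareto_quantile_iff[OF assms] p I by (auto)
  finally show "measure (std_pareto \<eta>) {p..} = disagreement_inv \<eta> (1 / p)" using I by simp
qed

text \<open>The law of \<open>r * Y\<close>; for \<eta> = 0 it is the equal-revenue law with tail
  \<open>r / p\<close>.\<close>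

definition pareto :: "real \<Rightarrow> real \<Rightarrow> real measure" where
  "pareto \<eta> r = distr (std_pareto \<eta>) borel (\<lambda>y. r * y)"

lemma pareto_props:
  assumes "\<eta> \<ge> 0" "0 < r"
  shows real_distribution_pareto: "real_distribution (pareto \<eta> r)"
    and pareto_AE: "AE s in pareto \<eta> r. r \<le> s"
    and pareto_tail: "r < p \<Longrightarrow> measure (pareto \<eta> r) {p..} = disagreement_inv \<eta> (r / p)"
proof -
  interpret Q: real_distribution "std_pareto \<eta>" using assms(1) by (rule real_distribution_std_pareto)
  interpret prob_space "pareto \<eta> r" unfolding pareto_def by (rule Q.prob_space_distr) simp
  show "real_distribution (pareto \<eta> r)" by unfold_locales (auto simp: pareto_def)
  show "AE s in pareto \<eta> r. r \<le> s"
    unfolding pareto_def using std_pareto_AE[OF assms(1)] assms(2) by (subst AE_distr_iff) auto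
  assume "r < p"
  then show "measure (pareto \<eta> r) {p..} = disagreement_inv \<eta> (r / p)"
    using std_pareto_tail[OF assms(1), of "p / r"] assms(2)
    by (simp add: pareto_def measure_distr vimage_def atLeast_def pos_divide_le_eq mult.commute)
qed

lemma nonneg_distribution_pareto:
  assumes "\<eta> \<ge> 0" "0 < r"
  shows "nonneg_distribution (pareto \<eta> r)"
proof -
  interpret real_distribution "pareto \<eta> r" using assms by (rule real_distribution_pareto)
  show ?thesis using pareto_AE[OF assms] assms(2) by unfold_locales auto
qed

section \<open>Truncated means of the Pareto laws\<close>

lemma mean_min_pareto_below:
  assumes "\<eta> \<ge> 0" "0 < r" "x \<le> r"
  shows "mean_min (pareto \<eta> r) x = x"
proof -
  interpret real_distribution "pareto \<eta> r" using assms(1,2) by (rule real_distribution_pareto)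
  have "mean_min (pareto \<eta> r) x = (LINT s|pareto \<eta> r. x)" unfolding mean_min_def
    using pareto_AE[OF assms(1,2)] assms(3) by (intro integral_cong_AE) auto
  then show ?thesis using prob_space by simp
qed

lemma mean_min_pareto_above:
  assumes "\<eta> \<ge> 0" "0 < r" "r \<le> x"
  shows "r \<le> mean_min (pareto \<eta> r) x"
  using nonneg_distribution.mean_min_mono[OF nonneg_distribution_pareto, of \<eta> r r x]
    mean_min_pareto_below[of \<eta> r r] assms by simp

text \<open>The gain from \<open>x\<close> to \<open>y\<close> is at least \<open>(y - x)\<close>
  times the tail at \<open>y\<close>, and every tail is positive.\<close>

lemma mean_min_pareto_strict_mono:
  assumes "\<eta> \<ge> 0" "0 < r" "r \<le> x" "x < y"
  shows "mean_min (pareto \<eta> r) x < mean_min (pareto \<eta> r) y"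
proof -
  interpret nonneg_distribution "pareto \<eta> r" using assms(1,2) by (rule nonneg_distribution_pareto)
  have "(LINT s|pareto \<eta> r. min s x + (y - x) * indicator {y..} s) \<le> mean_min (pareto \<eta> r) y"
    unfolding mean_min_def using assms
    by (intro integral_mono Bochner_Integration.integrable_add integrable_min integrable_scaled_tail)
      (auto simp: indicator_def)
  moreover have "(LINT s|pareto \<eta> r. min s x + (y - x) * indicator {y..} s)
      = mean_min (pareto \<eta> r) x + (LINT s|pareto \<eta> r. (y - x) * indicator {y..} s)"
    unfolding mean_min_def
    by (rule Bochner_Integration.integral_add[OF integrable_min integrable_scaled_tail])
      (use assms in simp)
  moreover have "(LINT s|pareto \<eta> r. (y - x) * indicator {y..} s) = (y - x) * disagreement_inv \<eta> (r / y)"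
    using pareto_tail[OF assms(1,2), of y] assms by (simp add: emeasure_eq_measure)
  moreover have "0 < (y - x) * disagreement_inv \<eta> (r / y)"
    using disagreement_inv_pos[of \<eta> "r / y"] assms by simp
  ultimately show ?thesis by linarith
qed

lemma mean_min_pareto_eq:
  assumes "\<eta> \<ge> 0"
  shows "mean_min (pareto \<eta> r) x = (LINT y|std_pareto \<eta>. min (r * y) x)"
proof -
  interpret Q: real_distribution "std_pareto \<eta>" using assms by (rule real_distribution_std_pareto)
  show ?thesis unfolding mean_min_def pareto_def by (subst integral_distr) auto
qed

text \<open>Pointwise, \<open>\<theta> * min (r * y) x = min (\<theta> * r * y) (\<theta> * x) \<le>
  min (\<theta> * r * y) x\<close>. This controls \<rho> when the price parameter is
  lowered.\<close>

lemma mean_min_pareto_scale: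
  assumes "\<eta> \<ge> 0" "0 < r" "0 < \<theta>" "\<theta> \<le> 1" "0 \<le> x"
  shows "\<theta> * mean_min (pareto \<eta> r) x \<le> mean_min (pareto \<eta> (\<theta> * r)) x"
proof -
  interpret Q: real_distribution "std_pareto \<eta>" using assms(1) by (rule real_distribution_std_pareto)
  have int: "integrable (std_pareto \<eta>) (\<lambda>y. min (c * y) x)" if "0 < c" for c
    using std_pareto_AE[OF assms(1)] assms(5) that
    by (intro Q.integrable_const_bound[of _ x]) auto
  have "\<theta> * min (r * y) x \<le> min (\<theta> * r * y) x" for y
    using assms mult_left_le_one_le[of x \<theta>]
    by (auto simp: min_mult_distrib_left mult.assoc intro: min.coboundedI1 min.coboundedI2)
  then have "(LINT y|std_pareto \<eta>. \<theta> * min (r * y) x) \<le> (LINT y|std_pareto \<eta>. min (\<theta> * r * y) x)"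
    using assms by (intro integral_mono) (auto intro!: int integrable_mult_right)
  then show ?thesis using assms(1) by (simp add: mean_min_pareto_eq)
qed

text \<open>Split at \<open>Y = k\<close>: the lower part contributes at most \<open>r * k\<close>,
  the upper part at most \<open>I (1 / k) \<le> 1 / k\<close>. It keeps feasible prices away from
  0.\<close>

lemma mean_min_pareto_small:
  assumes "\<eta> \<ge> 0" "0 < r" "1 < k"
  shows "mean_min (pareto \<eta> r) 1 \<le> r * k + 1 / k"
proof -
  interpret Q: real_distribution "std_pareto \<eta>" using assms(1) by (rule real_distribution_std_pareto)
  have "(LINT y|std_pareto \<eta>. min (r * y) 1) \<le> (LINT y|std_pareto \<eta>. r * k + indicator {k..} y)"
  proof (rule integral_mono)
    show "integrable (std_pareto \<eta>) (\<lambda>y. min (r * y) 1)"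
      using std_pareto_AE[OF assms(1)] assms(2) by (intro Q.integrable_const_bound[of _ 1]) auto
    show "min (r * y) 1 \<le> r * k + indicator {k..} y" for y
      using assms by (auto simp: indicator_def min_le_iff_disj)
  qed (simp add: Q.emeasure_eq_measure)
  also have "\<dots> = r * k + disagreement_inv \<eta> (1 / k)"
    using std_pareto_tail[OF assms(1,3)] Q.prob_space by (simp add: Q.emeasure_eq_measure)
  also have "\<dots> \<le> r * k + 1 / k" using disagreement_inv_le[of \<eta> "1 / k"] assms by simp
  finally show ?thesis using assms(1) by (simp add: mean_min_pareto_eq)
qed

lemma mean_min_shifted_pareto:
  assumes "\<eta> \<ge> 0" "unit_distribution G" "0 < r" "0 \<le> p" "p \<le> x"
    and "\<And>t. p < t \<Longrightarrow> measure G {t..} \<le> disagreement_inv \<eta> (r / (t - p + r))"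
  shows "mean_min G x - mean_min G p \<le> mean_min (pareto \<eta> r) (x - p + r) - r"
proof -
  interpret G: nonneg_distribution G using assms(2) by (rule unit_distribution_nonneg_distribution)
  interpret P: nonneg_distribution "pareto \<eta> r" using assms(1,3) by (rule nonneg_distribution_pareto)
  \<comment> \<open>The law of \<open>r * Y\<close> shifted up by \<open>p - r\<close>, so that it
    starts at \<open>p\<close>.\<close>
  let ?N = "distr (pareto \<eta> r) borel (\<lambda>s. s - r + p)"
  interpret N: prob_space ?N by (rule P.prob_space_distr) simp
  have N: "real_distribution ?N" by unfold_locales auto
  have tail: "measure G {t..} \<le> measure ?N {t..}" if "p < t" for t
  proof -
    have "measure ?N {t..} = measure (pareto \<eta> r) {t - p + r..}"
      by (subst measure_distr) (auto simp: vimage_def atLeast_def algebra_simps)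
    then show ?thesis using assms(6)[OF that] pareto_tail[OF assms(1,3), of "t - p + r"] that by simp
  qed
  have "mean_min G x - mean_min G p + p = (LINT s|G. min s x - min s p + p)"
    using assms(4,5) G.prob_space by (simp add: mean_min_def G.integrable_min)
  also have "\<dots> = (LINT s|G. min (max s p) x)"
    using assms(5) by (intro Bochner_Integration.integral_cong) auto
  also have "\<dots> \<le> (LINT s|?N. min (max s p) x)"
    using tail assms(5) by (intro clamped_mean_mono_tail N G.real_distribution_axioms) auto
  also have "\<dots> = (LINT s|pareto \<eta> r. min (max (s - r + p) p) x)"
    by (subst integral_distr) auto
  also have "\<dots> = (LINT s|pareto \<eta> r. min s (x - p + r) - r + p)"
    using pareto_AE[OF assms(1,3)] by (intro integral_cong_AE) auto
  also have "\<dots> = mean_min (pareto \<eta> r) (x - p + r) - r + p"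
    using assms(3,5) P.prob_space by (simp add: mean_min_def P.integrable_min)
  finally show ?thesis by simp
qed

section \<open>Truncated laws: support and seller price\<close>

text \<open>Capping at \<open>B\<close> keeps the tail up to and including \<open>B\<close> and
  collects the remaining mass in an atom at \<open>B\<close>.\<close>

definition truncated_pareto :: "real \<Rightarrow> real \<Rightarrow> real \<Rightarrow> real measure" where
  "truncated_pareto \<eta> r B = distr (pareto \<eta> r) borel (\<lambda>s. min s B)"

context
  fixes \<eta> r B :: real
  assumes \<eta>: "\<eta> \<ge> 0" and r: "0 < r" "r \<le> B" "B \<le> 1"
begin

lemma unit_distribution_truncated_pareto: "unit_distribution (truncated_pareto \<eta> r B)"
proof -
  interpret P: real_distribution "pareto \<eta> r" using \<eta> r(1) by (rule real_distribution_pareto)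
  show ?thesis
  proof (rule unit_distributionI)
    show "prob_space (truncated_pareto \<eta> r B)"
      unfolding truncated_pareto_def by (rule P.prob_space_distr) simp
    show "AE s in truncated_pareto \<eta> r B. s \<in> {0..1}"
      unfolding truncated_pareto_def using pareto_AE[OF \<eta> r(1)] r by (subst AE_distr_iff) auto
  qed (simp add: truncated_pareto_def)
qed

lemma truncated_pareto_tail:
  shows truncated_pareto_tail_below: "p \<le> r \<Longrightarrow> measure (truncated_pareto \<eta> r B) {p..} = 1"
    and truncated_pareto_tail_mid:
      "r < p \<Longrightarrow> p \<le> B \<Longrightarrow> measure (truncated_pareto \<eta> r B) {p..} = disagreement_inv \<eta> (r / p)"
    and truncated_pareto_tail_above: "B < p \<Longrightarrow> measure (truncated_pareto \<eta> r B) {p..} = 0"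
proof -
  interpret P: real_distribution "pareto \<eta> r" using \<eta> r(1) by (rule real_distribution_pareto)
  have eq: "measure (truncated_pareto \<eta> r B) {p..} = (if p \<le> B then measure (pareto \<eta> r) {p..} else 0)" for p
  proof -
    have "(\<lambda>s. min s B) -` {p..} = (if p \<le> B then {p..} else {})" by auto
    then show ?thesis by (simp add: truncated_pareto_def measure_distr)
  qed
  show "r < p \<Longrightarrow> p \<le> B \<Longrightarrow> measure (truncated_pareto \<eta> r B) {p..} = disagreement_inv \<eta> (r / p)"
    by (simp add: eq pareto_tail[OF \<eta> r(1)])
  show "B < p \<Longrightarrow> measure (truncated_pareto \<eta> r B) {p..} = 0"
    by (simp add: eq)
  assume "p \<le> r"
  then have "P.prob {p..} = 1"
    using pareto_AE[OF \<eta> r(1)] by (auto intro!: P.prob_eq_1[THEN iffD2] elim: eventually_mono)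
  then show "measure (truncated_pareto \<eta> r B) {p..} = 1"
    using \<open>p \<le> r\<close> r by (simp add: eq)
qed

lemma mean_min_truncated_pareto: "mean_min (truncated_pareto \<eta> r B) x = mean_min (pareto \<eta> r) (min x B)"
proof -
  interpret P: real_distribution "pareto \<eta> r" using \<eta> r(1) by (rule real_distribution_pareto)
  have "mean_min (truncated_pareto \<eta> r B) x = (LINT s|pareto \<eta> r. min (min s B) x)"
    unfolding mean_min_def truncated_pareto_def by (subst integral_distr) auto
  then show ?thesis by (simp add: mean_min_def min.assoc min.commute[of B x])
qed

text \<open>Inside \<open>{r..B}\<close> the tail drops strictly across every window: from 1 at
  \<open>r\<close>, by strict monotonicity of the inverse in between, and to 0 past
  \<open>B\<close>.\<close>

lemma msupport_truncated_pareto: "msupport (truncated_pareto \<eta> r B) = {r..B}"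
proof (intro equalityI subsetI)
  let ?G = "truncated_pareto \<eta> r B"
  interpret G: real_distribution ?G
    using unit_distribution_truncated_pareto by (rule unit_distribution_real_distribution)
  interpret P: real_distribution "pareto \<eta> r" using \<eta> r(1) by (rule real_distribution_pareto)
  {
    fix s assume s: "s \<in> msupport ?G"
    have "measure ?G {..<r} = 1 - measure ?G {r..}"
      using G.prob_compl[of "{r..}"] by (simp add: Compl_eq_Diff_UNIV[symmetric])
    then have "measure ?G {..<r} = 0" using truncated_pareto_tail_below[of r] by simp
    moreover have "measure ?G {B<..} = 0"
    proof -
      have "measure ?G {B<..} \<le> 1 - measure ?G {..B}"
        using G.prob_compl[of "{..B}"] by (simp add: Compl_eq_Diff_UNIV[symmetric])
      moreover have "AE s in ?G. s \<in> {..B}"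
        unfolding truncated_pareto_def by (subst AE_distr_iff) auto
      then have "measure ?G {..B} = 1" by (intro G.prob_eq_1[THEN iffD2]) auto
      ultimately show ?thesis by (simp add: measure_le_0_iff)
    qed
    ultimately show "s \<in> {r..B}"
      using s unfolding msupport_def
      by (auto simp: not_le[symmetric] dest: spec[of _ "{..<r}"] spec[of _ "{B<..}"])
  next
    fix s assume s: "s \<in> {r..B}"
    show "s \<in> msupport ?G" unfolding msupport_def
    proof safe
      fix U assume U: "open U" "s \<in> U"
      then obtain e where e: "e > 0" "ball s e \<subseteq> U" by (auto simp: open_contains_ball)
      define p q where "p = s - e / 2" and "q = s + e / 2"
      have "{p..<q} \<subseteq> U" using e by (auto simp: p_def q_def dist_real_def intro!: subsetD[OF e(2)])
      then have le: "measure ?G {p..<q} \<le> measure ?G U"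
        using U by (intro G.finite_measure_mono) auto
      have eq: "measure ?G {p..} = measure ?G {p..<q} + measure ?G {q..}"
        using e by (subst G.finite_measure_Union[symmetric]) (auto simp: ivl_disj_un p_def q_def)
      have "q > r" using s e by (simp add: q_def)
      have I1: "disagreement_inv \<eta> (r / t) < 1" "0 < disagreement_inv \<eta> (r / t)" if "r < t" for t
        using disagreement_inv_le[of \<eta> "r / t"] disagreement_inv_pos[of \<eta> "r / t"] \<eta> r that
        by (auto intro: le_less_trans)
      have "measure ?G {q..} < measure ?G {p..}"
      proof (cases "q \<le> B")
        case True
        then have q: "measure ?G {q..} = disagreement_inv \<eta> (r / q)"
          using truncated_pareto_tail_mid \<open>q > r\<close> by simp
        show ?thesis
        proof (cases "p \<le> r")
          case True
          then show ?thesis using q truncated_pareto_tail_below I1 \<open>q > r\<close> by simp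
        next
          case False
          have "p < q" using e by (simp add: p_def q_def)
          then have "disagreement_inv \<eta> (r / q) < disagreement_inv \<eta> (r / p)"
            using False r \<eta> by (intro disagreement_inv_strict_mono) (auto simp: field_simps)
          then show ?thesis
            using q truncated_pareto_tail_mid[of p] False \<open>p < q\<close> \<open>q \<le> B\<close> by simp
        qed
      next
        case False
        have "p \<le> B" using s e by (simp add: p_def)
        then have "0 < measure ?G {p..}"
          using truncated_pareto_tail_below[of p] truncated_pareto_tail_mid[of p] I1[of p]
          by (cases "p \<le> r") auto
        then show ?thesis using False truncated_pareto_tail_above by simp
      qed
      then show "0 < measure ?G U" using le eq by simp
    qed
  }
qed

text \<open>Beliefs inherit the null sets below \<open>r\<close> and above \<open>B\<close>. In
  between, the tail of \<open>G\<close> is the mass that an admissible belief can raise at most to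
  \<open>r / p\<close>, so no price earns more than \<open>r\<close>.\<close>

lemma seller_price_truncated_pareto:
  assumes H: "admissible \<eta> (truncated_pareto \<eta> r B) H"
  shows "seller_price H = r"
proof (rule seller_price_eqI)
  note G = unit_distribution_truncated_pareto
  show uH: "unit_distribution H" using H by (simp add: admissible_def)
  interpret H: real_distribution H using uH by (rule unit_distribution_real_distribution)
  interpret G: real_distribution "truncated_pareto \<eta> r B"
    using G by (rule unit_distribution_real_distribution)
  show "r \<in> {0..1}" using r by simp
  have "measure (truncated_pareto \<eta> r B) {..<r} = 0"
    using truncated_pareto_tail_below[of r] G.prob_compl[of "{r..}"]
    by (simp add: Compl_eq_Diff_UNIV[symmetric])
  then have "measure H {..<r} = 0" by (intro admissible_null[OF H G]) auto
  then show "measure H {r..} = 1"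
    using H.prob_compl[of "{..<r}"] by (simp add: Compl_eq_Diff_UNIV[symmetric])
  fix p :: real assume p: "p \<in> {0..1}"
  consider "p \<le> r" | "B < p" | "r < p" "p \<le> B" by linarith
  then show "p * measure H {p..} \<le> r"
  proof cases
    case 1
    then show ?thesis using p mult_left_le[of "measure H {p..}" p] by simp
  next
    case 2
    then have "measure H {p..} = 0"
      using truncated_pareto_tail_above by (intro admissible_null[OF H G]) auto
    then show ?thesis using r by simp
  next
    case 3
    define x where "x = r / p"
    define y where "y = disagreement_inv \<eta> x"
    have x: "0 < x" "x < 1" using 3 r by (auto simp: x_def)
    note I = disagreement_inv_props[OF \<eta> x, folded y_def]
    have y: "y = measure (truncated_pareto \<eta> r B) {p..}"
      using 3 truncated_pareto_tail_mid by (simp add: y_def x_def)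
    have "measure H {p..} \<le> x"
    proof (rule ccontr)
      let ?h = "measure H {p..}"
      assume "\<not> ?thesis"
      \<comment> \<open>The tail under \<open>H\<close> may equal 1; an intermediate
        \<open>z < 1\<close> keeps the logarithms meaningful. The two-point expression is affine in
        that tail with nonnegative slope, hence at least its value \<open>d_KL z y\<close> at
        \<open>z\<close>.\<close>
      then obtain z where z: "x < z" "z < ?h" using dense[of x ?h] by auto
      then have "z < 1" using H.prob_le_1[of "{p..}"] by linarith
      have "?h * ln (z / y) + (1 - ?h) * ln ((1 - z) / (1 - y)) \<le> \<eta>"
        using z x I \<open>z < 1\<close> by (intro admissible_two_point_bound[OF H G _ y]) auto
      moreover have "?h * ln (z / y) + (1 - ?h) * ln ((1 - z) / (1 - y))
          = d_KL z y + (?h - z) * (ln (z / y) + ln ((1 - y) / (1 - z)))"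
        using z x I \<open>z < 1\<close> by (simp add: d_KL_def ln_div algebra_simps)
      moreover have "0 \<le> (?h - z) * (ln (z / y) + ln ((1 - y) / (1 - z)))"
        using z x I \<open>z < 1\<close> by (intro mult_nonneg_nonneg add_nonneg_nonneg ln_ge_zero) auto
      moreover have "\<eta> < d_KL z y"
        using d_KL_strict_mono[of y x z] I z \<open>z < 1\<close> by simp
      ultimately show False by linarith
    qed
    then show ?thesis using 3 r by (simp add: x_def field_simps)
  qed
qed

end

section \<open>Upper bound on the robust surplus\<close>

text \<open>If the bound failed at \<open>t\<close>, the belief tilted at \<open>t\<close> would make every price up to \<open>p\<close>
  worse than \<open>t\<close>: since \<open>q * G {q..} \<le> r\<close> for \<open>q \<le> p\<close>, its revenue at such \<open>q\<close> is at most a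
  convex combination of \<open>p\<close> and \<open>r\<close>.\<close>

lemma tail_bound_above_prices:
  assumes "\<eta> \<ge> 0" "unit_distribution G" "0 \<le> p" "r = mean_min G p" "0 < r"
    and price: "\<And>H. admissible \<eta> G H \<Longrightarrow> seller_price H \<le> p"
    and "p < t"
  shows "measure G {t..} \<le> disagreement_inv \<eta> (r / (t - p + r))"
proof (rule ccontr)
  interpret G: nonneg_distribution G using assms(2) by (rule unit_distribution_nonneg_distribution)
  define x where "x = r / (t - p + r)"
  define y where "y = measure G {t..}"
  have x: "0 < x" "x < 1" using assms(5,7) by (auto simp: x_def)
  assume "\<not> ?thesis"
  then have Iy: "disagreement_inv \<eta> x < y" by (simp add: x_def y_def)
  have "0 < y" using disagreement_inv_pos[OF assms(1) x] Iy by simp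
  \<comment> \<open>So \<open>t\<close> is among the prices open to the seller.\<close>
  then have "t \<le> 1" using unit_distribution_tail_eq_0[OF assms(2), of t] by (force simp: y_def)
  have "r \<le> p" using G.mean_min_le assms(3,4) by simp
  have rev: "q * measure G {q..} \<le> r" if "0 \<le> q" "q \<le> p" for q
    using G.tail_le_mean_min[OF that(1)] G.mean_min_mono[OF that] assms(4) by simp
  have rx: "r = x * (t - p + r)" using assms(5,7) by (simp add: x_def)
  have False if H: "admissible \<eta> G H"
    and less: "\<And>q. 0 \<le> q \<Longrightarrow> q \<le> p \<Longrightarrow> q * measure H {q..} < t * measure H {t..}" for H
  proof -
    have uH: "unit_distribution H" using H by (simp add: admissible_def)
    have "t * measure H {t..} \<le> seller_price H * measure H {seller_price H..}"
      using seller_price_optimal[OF uH, of t] \<open>t \<le> 1\<close> assms(3,7) by simp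
    then show False using less[of "seller_price H"] price H seller_price_range[OF uH] by auto
  qed note * = this
  \<comment> \<open>For \<open>x < y\<close> the belief \<open>G\<close> itself prefers
    \<open>t\<close> to all prices up to \<open>p\<close>. Otherwise the slack in the divergence
    allows a tilt giving \<open>{t..}\<close> a mass \<open>h > x\<close>.\<close>
  show False
  proof (cases "x < y")
    case True
    show False
    proof (rule *[OF admissible_self[OF assms(1,2)]])
      fix q assume q: "0 \<le> q" "q \<le> p"
      have "r \<le> x * t" using \<open>r \<le> p\<close> x rx mult_left_mono[of "t - p + r" t x] by simp
      also have "\<dots> < t * y" using True assms(3,7) by (simp add: mult.commute)
      finally show "q * measure G {q..} < t * measure G {t..}" using rev[OF q] by (simp add: y_def)
    qed
  next
    case False
    then obtain h where h: "x < h" "h < 1" "d_KL h y < \<eta>"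
      using d_KL_less_right_nbhd[OF assms(1) x Iy] by auto
    have y: "y < 1" "y < h" using False x h by auto
    obtain H where H: "admissible \<eta> G H"
      and tail: "\<And>q. q \<le> t \<Longrightarrow> measure H {q..} = 1 - (1 - h) / (1 - y) * (1 - measure G {q..})"
      using tilt_admissible[OF assms(2) \<open>0 < y\<close> \<open>y < 1\<close> y_def, of h \<eta>] h x by auto
    define c where "c = (1 - h) / (1 - y)"
    have c: "1 - h \<le> c" "c \<le> 1" "c * (1 - y) = 1 - h"
      using y h x \<open>0 < y\<close> by (auto simp: c_def field_simps)
    show False
    proof (rule *[OF H])
      fix q assume q: "0 \<le> q" "q \<le> p"
      have Hq: "measure H {q..} = 1 - c * (1 - measure G {q..})"
        using tail[of q] q assms(7) by (simp add: c_def)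
      have "q * measure H {q..} = (1 - c) * q + c * (q * measure G {q..})"
        unfolding Hq by (simp add: algebra_simps)
      also have "\<dots> \<le> (1 - c) * p + c * r"
        using c h y q rev[OF q] by (intro add_mono mult_left_mono) auto
      also have "\<dots> = p - c * (p - r)" by (simp add: algebra_simps)
      \<comment> \<open>Since \<open>1 - h \<le> c\<close> and \<open>r \<le> p\<close>, replacing
        \<open>c\<close> by \<open>1 - h\<close> can only raise the bound; the result is below
        \<open>h * t\<close> because \<open>r = x * (t - p + r)\<close> and
        \<open>x < h\<close>.\<close>
      also have "\<dots> \<le> p - (1 - h) * (p - r)"
        using c \<open>r \<le> p\<close> by (intro diff_left_mono mult_right_mono) auto
      also have "\<dots> = h * p + (1 - h) * r" by (simp add: algebra_simps)
      also have "\<dots> < h * t"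
      proof -
        have "r < h * (t - p + r)"
          using h assms(5,7) mult_strict_right_mono[of x h "t - p + r"] rx by simp
        then show ?thesis by (simp add: algebra_simps)
      qed
      also have "h * t = t * measure H {t..}"
        using tail[of t] c by (simp add: y_def[symmetric] c_def[symmetric])
      finally show "q * measure H {q..} < t * measure H {t..}" .
    qed
  qed
qed

text \<open>The order half of Bayes plausibility for the untruncated law; the cap \<open>B\<close>
  later adjusts the mean.\<close>

definition feasible :: "real \<Rightarrow> real measure \<Rightarrow> real \<Rightarrow> bool" where
  "feasible \<eta> F r \<longleftrightarrow> 0 < r \<and> (\<forall>x\<in>{0..1}. mean_min F x \<le> mean_min (pareto \<eta> r) x)"

lemma robust_surplus_le:
  assumes "unit_distribution G" "admissible \<eta> G H"
  shows "robust_surplus \<eta> G \<le> mean_min G 1 - mean_min G (seller_price H)"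
proof -
  interpret G: nonneg_distribution G using assms(1) by (rule unit_distribution_nonneg_distribution)
  have eq: "buyer_surplus G (seller_price K) = mean_min G 1 - mean_min G (seller_price K)"
    and nn: "0 \<le> buyer_surplus G (seller_price K)" if "admissible \<eta> G K" for K
    using that seller_price_range[of K] G.mean_min_mono[of "seller_price K" 1] assms(1)
    by (auto simp: buyer_surplus_eq admissible_def)
  have "robust_surplus \<eta> G \<le> buyer_surplus G (seller_price H)"
    unfolding robust_surplus_def using assms(2) nn by (intro cINF_lower bdd_belowI2) auto
  then show ?thesis using eq[OF assms(2)] by simp
qed

text \<open>Here \<open>p\<close> is the supremum of the induced prices. The last conclusion keeps
  the domination by the shifted law, whose gap later rules out lost trade.\<close>

lemma robust_surplus_feasible:
  assumes "\<eta> \<ge> 0" "unit_distribution F" "bayes_plausible F G" "0 < mean_min F 1"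
  obtains p where "\<forall>H. admissible \<eta> G H \<longrightarrow> seller_price H \<le> p" "p \<in> {0..1}"
    and "feasible \<eta> F (mean_min G p)" "robust_surplus \<eta> G \<le> mean_min F 1 - mean_min G p"
    and "\<forall>x\<ge>p. mean_min G x \<le> mean_min (pareto \<eta> (mean_min G p)) (x - p + mean_min G p)"
proof -
  have uG: "unit_distribution G" and FG: "\<And>x. x \<in> {0..1} \<Longrightarrow> mean_min F x \<le> mean_min G x"
    and G1: "mean_min G 1 = mean_min F 1"
    using assms(3) bayes_plausible_iff[OF assms(2)] by auto
  interpret G: nonneg_distribution G using uG by (rule unit_distribution_nonneg_distribution)
  define P where "P = seller_price ` {H. admissible \<eta> G H}"
  have P01: "q \<in> {0..1}" if "q \<in> P" for q
    using that seller_price_range unfolding P_def admissible_def by blast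
  have bdd: "bdd_above P" using P01 by (intro bdd_aboveI[of _ 1]) auto
  define p where "p = Sup P"
  have GP: "seller_price G \<in> P" using admissible_self[OF assms(1) uG] by (auto simp: P_def)
  have le: "q \<le> p" if "q \<in> P" for q using that bdd by (auto simp: p_def intro: cSup_upper)
  have p01: "p \<in> {0..1}"
    using le[OF GP] P01 GP cSup_least[of P 1] by (force simp: p_def)
  define r where "r = mean_min G p"
  \<comment> \<open>Signals are at most \<open>m / 2\<close> plus the indicator of
    \<open>{m / 2..}\<close>, so that tail is positive and the price \<open>m / 2\<close> earns
    revenue. The optimal revenue under \<open>G\<close> is then positive, and \<rho> bounds
    it.\<close>
  have "0 < r"
  proof -
    define m where "m = mean_min F 1"
    have m: "0 < m" "m \<le> 1" using assms(4) G.mean_min_le[of 1] G1 by (auto simp: m_def)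
    have "m = (LINT s|G. s)" using G1 mean_min_1[OF uG] by (simp add: m_def)
    also have "\<dots> \<le> (LINT s|G. m / 2 + 1 * indicator {m / 2..} s)"
    proof (rule integral_mono_AE)
      show "integrable G (\<lambda>s. s)" by (rule unit_distribution_integrable[OF uG, of _ 1]) auto
      show "integrable G (\<lambda>s. m / 2 + 1 * indicator {m / 2..} s)"
        by (intro Bochner_Integration.integrable_add G.integrable_scaled_tail) simp
      show "AE s in G. s \<le> m / 2 + 1 * indicator {m / 2..} s"
        by (rule eventually_mono[OF unit_distribution_AE[OF uG]]) (use m in \<open>auto simp: indicator_def\<close>)
    qed
    also have "\<dots> = m / 2 + measure G {m / 2..}"
      using G.prob_space by (simp add: G.emeasure_eq_measure)
    finally have "0 < m / 2 * measure G {m / 2..}" using m by simp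
    also have "\<dots> \<le> seller_price G * measure G {seller_price G..}"
      using seller_price_optimal[OF uG, of "m / 2"] m by simp
    also have "\<dots> \<le> mean_min G (seller_price G)"
      using P01[OF GP] by (intro G.tail_le_mean_min) auto
    also have "\<dots> \<le> r" unfolding r_def using P01[OF GP] le[OF GP] by (intro G.mean_min_mono) auto
    finally show ?thesis .
  qed
  have tail: "measure G {t..} \<le> disagreement_inv \<eta> (r / (t - p + r))" if "p < t" for t
    using tail_bound_above_prices[OF assms(1) uG _ r_def \<open>0 < r\<close> _ that] p01 le
    by (auto simp: P_def)
  have above: "mean_min G x \<le> mean_min (pareto \<eta> r) (x - p + r)" if "p \<le> x" for x
    using mean_min_shifted_pareto[OF assms(1) uG \<open>0 < r\<close> _ that tail] p01 by (simp add: r_def)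
  have "r \<le> p" unfolding r_def using p01 by (intro G.mean_min_le) auto
  interpret Q: nonneg_distribution "pareto \<eta> r"
    using assms(1) \<open>0 < r\<close> by (rule nonneg_distribution_pareto)
  have dom: "mean_min G x \<le> mean_min (pareto \<eta> r) x" if x: "x \<in> {0..1}" for x
  proof -
    consider "x \<le> r" | "r \<le> x" "x \<le> p" | "p \<le> x" by linarith
    then show ?thesis
    proof cases
      case 1
      then show ?thesis using mean_min_pareto_below[OF assms(1) \<open>0 < r\<close>] G.mean_min_le x by auto
    next
      case 2
      have "mean_min G x \<le> r" unfolding r_def using x 2 by (intro G.mean_min_mono) auto
      then show ?thesis using mean_min_pareto_above[OF assms(1) \<open>0 < r\<close> 2(1)] by simp
    next
      case 3
      have "mean_min (pareto \<eta> r) (x - p + r) \<le> mean_min (pareto \<eta> r) x"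
        using 3 \<open>r \<le> p\<close> \<open>0 < r\<close> by (intro Q.mean_min_mono) auto
      then show ?thesis using above[OF 3] by simp
    qed
  qed
  have "feasible \<eta> F r" using \<open>0 < r\<close> order_trans[OF FG dom] by (simp add: feasible_def)
  \<comment> \<open>The supremum \<open>p\<close> may not be attained; the Lipschitz bound on \<rho>
    transfers the estimate from induced prices close to \<open>p\<close>.\<close>
  moreover have "robust_surplus \<eta> G \<le> mean_min F 1 - mean_min G p"
  proof (rule field_le_epsilon)
    fix e :: real assume "0 < e"
    then obtain q where q: "q \<in> P" "p - e < q"
      using less_cSup_iff[of P "p - e"] GP bdd by (auto simp: p_def)
    then obtain H where H: "admissible \<eta> G H" "q = seller_price H" by (auto simp: P_def)
    have "mean_min G p \<le> mean_min G q + (p - q)"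
      using P01[OF q(1)] le[OF q(1)] by (intro G.mean_min_Lipschitz) auto
    then show "robust_surplus \<eta> G \<le> mean_min F 1 - mean_min G p + e"
      using robust_surplus_le[OF uG H(1)] H(2) q(2) G1 by simp
  qed
  ultimately show ?thesis
    using that[of p] le p01 above unfolding P_def r_def by blast
qed

section \<open>The lowest feasible price\<close>

text \<open>The mean \<open>m\<close> is feasible and feasible prices are at least
  \<open>m\<^sup>2 / 4\<close>, so their infimum is positive. Scaling shows both that it is feasible
  and that a strict gap would allow a lower price.\<close>

lemma least_feasible:
  assumes "\<eta> \<ge> 0" "unit_distribution F" "0 < mean_min F 1"
  obtains r where "feasible \<eta> F r" "\<And>r'. feasible \<eta> F r' \<Longrightarrow> r \<le> r'" "r \<le> mean_min F 1"
    and "\<exists>x\<in>{r..1}. mean_min (pareto \<eta> r) x \<le> mean_min F x"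
proof -
  interpret F: nonneg_distribution F using assms(2) by (rule unit_distribution_nonneg_distribution)
  define m where "m = mean_min F 1"
  have m: "0 < m" "m \<le> 1" using assms(3) F.mean_min_le[of 1] by (auto simp: m_def)
  define R where "R = {r. feasible \<eta> F r}"
  have mR: "m \<in> R"
  proof -
    have "mean_min F x \<le> mean_min (pareto \<eta> m) x" if "x \<in> {0..1}" for x
    proof (cases "x \<le> m")
      case True
      then show ?thesis using mean_min_pareto_below[OF assms(1) m(1)] F.mean_min_le that by auto
    next
      case False
      then have "m \<le> mean_min (pareto \<eta> m) x"
        using mean_min_pareto_above[OF assms(1) m(1)] by simp
      moreover have "mean_min F x \<le> m" unfolding m_def using that by (intro F.mean_min_mono) auto
      ultimately show ?thesis by simp
    qed
    then show ?thesis using m by (simp add: R_def feasible_def)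
  qed
  have low: "m\<^sup>2 / 4 \<le> r" if "r \<in> R" for r
  proof -
    have r: "0 < r" "m \<le> mean_min (pareto \<eta> r) 1" using that by (auto simp: R_def feasible_def m_def)
    \<comment> \<open>The choice \<open>k = 2 / m\<close> makes the second term half of
      \<open>m\<close>.\<close>
    have "mean_min (pareto \<eta> r) 1 \<le> r * (2 / m) + 1 / (2 / m)"
      using m by (intro mean_min_pareto_small assms(1) r) auto
    then have "m / 2 \<le> r * (2 / m)" using r by simp
    then show ?thesis using m by (simp add: field_simps power2_eq_square)
  qed
  have bdd: "bdd_below R" using low by (intro bdd_belowI[of _ "m\<^sup>2 / 4"]) auto
  define r where "r = Inf R"
  have rle: "r \<le> r'" if "r' \<in> R" for r' using that bdd by (auto simp: r_def intro: cInf_lower)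
  have "m\<^sup>2 / 4 \<le> r" unfolding r_def using low mR by (intro cInf_greatest) auto
  then have "0 < r" using m by (smt (verit) zero_less_power divide_pos_pos)
  have scale: "r / r' * mean_min (pareto \<eta> r') x \<le> mean_min (pareto \<eta> r) x"
    if "r' \<in> R" "0 \<le> x" for r' x
    using mean_min_pareto_scale[of \<eta> r' "r / r'" x] that \<open>0 < r\<close> rle[of r'] assms(1) by simp
  interpret Q: nonneg_distribution "pareto \<eta> r"
    using assms(1) \<open>0 < r\<close> by (rule nonneg_distribution_pareto)
  have "mean_min F x \<le> mean_min (pareto \<eta> r) x" if x: "x \<in> {0..1}" for x
  proof (cases "x = 0")
    case True
    then show ?thesis
      using F.mean_min_le[of 0] mean_min_pareto_below[OF assms(1) \<open>0 < r\<close>, of 0] \<open>0 < r\<close> by simp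
  next
    case False
    let ?L = "mean_min (pareto \<eta> r) x"
    have L: "0 < ?L"
      using Q.mean_min_mono[of "min x r" x] mean_min_pareto_below[OF assms(1) \<open>0 < r\<close>, of "min x r"]
        x False \<open>0 < r\<close> by auto
    \<comment> \<open>This bound is uniform in \<open>r'\<close>, so it survives the infimum and
      yields \<open>mean_min F x \<le> ?L\<close>.\<close>
    have "r * mean_min F x / ?L \<le> r'" if r': "r' \<in> R" for r'
    proof -
      have "0 < r'" "mean_min F x \<le> mean_min (pareto \<eta> r') x"
        using r' x by (auto simp: R_def feasible_def)
      then have "r * mean_min F x \<le> r * mean_min (pareto \<eta> r') x" using \<open>0 < r\<close> by simp
      also have "\<dots> \<le> r' * ?L" using scale[OF r', of x] x \<open>0 < r'\<close> by (simp add: field_simps)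
      finally show ?thesis using L by (simp add: field_simps)
    qed
    then have "r * mean_min F x / ?L \<le> r" unfolding r_def using mR by (intro cInf_greatest) auto
    then show ?thesis using L \<open>0 < r\<close> by (simp add: field_simps)
  qed
  then have feas: "feasible \<eta> F r" using \<open>0 < r\<close> by (simp add: feasible_def)
  have "\<exists>x\<in>{r..1}. mean_min (pareto \<eta> r) x \<le> mean_min F x"
  proof (rule ccontr)
    assume "\<not> ?thesis"
    then have less: "\<And>x. x \<in> {r..1} \<Longrightarrow> mean_min F x < mean_min (pareto \<eta> r) x"
      by (auto simp: not_le)
    let ?g = "\<lambda>x. mean_min F x / mean_min (pareto \<eta> r) x"
    have pos: "0 < mean_min (pareto \<eta> r) x" if "r \<le> x" for x
      using mean_min_pareto_above[OF assms(1) \<open>0 < r\<close> that] \<open>0 < r\<close> by simp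
    have "r \<le> 1" using rle[OF mR] m by simp
    moreover have "continuous_on {r..1} ?g"
      using \<open>0 < r\<close> pos
      by (intro continuous_intros continuous_on_subset[OF F.continuous_on_mean_min]
          continuous_on_subset[OF Q.continuous_on_mean_min]) (auto simp: less_le)
    ultimately obtain z where z: "z \<in> {r..1}" "\<And>x. x \<in> {r..1} \<Longrightarrow> ?g x \<le> ?g z"
      using continuous_attains_sup[of "{r..1}" ?g] by auto
    \<comment> \<open>The largest ratio over \<open>{r..1}\<close> is below 1, so the price
      \<open>\<theta> * r\<close> would still be feasible; the maximum with \<open>1 / 2\<close>
      keeps \<theta> positive.\<close>
    define \<theta> where "\<theta> = max (?g z) (1 / 2)"
    have \<theta>: "0 < \<theta>" "\<theta> < 1" using less[OF z(1)] pos z(1) by (auto simp: \<theta>_def)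
    have above: "mean_min F x \<le> \<theta> * mean_min (pareto \<eta> r) x" if "x \<in> {r..1}" for x
    proof -
      have "?g x \<le> \<theta>" using z(2)[OF that] by (simp add: \<theta>_def)
      then show ?thesis using pos[of x] that by (simp add: pos_divide_le_eq)
    qed
    have "0 < \<theta> * r" using \<theta> \<open>0 < r\<close> by simp
    have "mean_min F x \<le> mean_min (pareto \<eta> (\<theta> * r)) x" if x: "x \<in> {0..1}" for x
    proof -
      consider "x \<le> \<theta> * r" | "\<theta> * r \<le> x" "x \<le> r" | "r \<le> x" by linarith
      then show ?thesis
      proof cases
        case 1
        then show ?thesis
          using mean_min_pareto_below[OF assms(1) \<open>0 < \<theta> * r\<close>] F.mean_min_le x by auto
      next
        case 2
        have "mean_min F x \<le> mean_min F r" using x 2 by (intro F.mean_min_mono) auto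
        also have "\<dots> \<le> \<theta> * r"
          using above[of r] \<open>r \<le> 1\<close> mean_min_pareto_below[OF assms(1) \<open>0 < r\<close>, of r] by simp
        also have "\<dots> \<le> mean_min (pareto \<eta> (\<theta> * r)) x"
          by (intro mean_min_pareto_above assms(1) \<open>0 < \<theta> * r\<close> 2)
        finally show ?thesis .
      next
        case 3
        then show ?thesis
          using above[of x] x mean_min_pareto_scale[OF assms(1) \<open>0 < r\<close>, of \<theta> x] \<theta> by auto
      qed
    qed
    then have "\<theta> * r \<in> R" using \<open>0 < \<theta> * r\<close> by (simp add: R_def feasible_def)
    then show False using rle[of "\<theta> * r"] \<theta> \<open>0 < r\<close> by simp
  qed
  with feas rle mR show ?thesis by (intro that[of r]) (auto simp: R_def m_def)
qed

text \<open>\<open>B\<close> is where \<rho> of the Pareto law reaches the mean of \<open>F\<close>.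
  Beyond \<open>B\<close> the capped \<rho> stays at that mean, above \<rho> of \<open>F\<close>;
  the price is always \<open>r\<close>, so the infimum is over a constant.\<close>

lemma feasible_truncated_pareto:
  assumes "\<eta> \<ge> 0" "unit_distribution F" "feasible \<eta> F r" "r \<le> mean_min F 1"
  obtains B where "r \<le> B" "B \<le> 1" "bayes_plausible F (truncated_pareto \<eta> r B)"
    and "robust_surplus \<eta> (truncated_pareto \<eta> r B) = mean_min F 1 - r"
proof -
  interpret F: nonneg_distribution F using assms(2) by (rule unit_distribution_nonneg_distribution)
  have "0 < r" and dom: "\<And>x. x \<in> {0..1} \<Longrightarrow> mean_min F x \<le> mean_min (pareto \<eta> r) x"
    using assms(3) by (auto simp: feasible_def)
  interpret Q: nonneg_distribution "pareto \<eta> r"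
    using assms(1) \<open>0 < r\<close> by (rule nonneg_distribution_pareto)
  have "mean_min (pareto \<eta> r) r = r" by (intro mean_min_pareto_below assms(1) \<open>0 < r\<close>) simp
  moreover have "r \<le> 1" using assms(4) F.mean_min_le[of 1] by simp
  moreover have "continuous_on {r..1} (mean_min (pareto \<eta> r))"
    using \<open>0 < r\<close> by (intro continuous_on_subset[OF Q.continuous_on_mean_min]) auto
  ultimately obtain B where B: "r \<le> B" "B \<le> 1" "mean_min (pareto \<eta> r) B = mean_min F 1"
    using IVT'[of "mean_min (pareto \<eta> r)" r "mean_min F 1" 1] assms(4) dom[of 1] by auto
  let ?G = "truncated_pareto \<eta> r B"
  note T = unit_distribution_truncated_pareto[OF assms(1) \<open>0 < r\<close> B(1,2)]
    mean_min_truncated_pareto[OF assms(1) \<open>0 < r\<close> B(1,2)]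
  have G1: "mean_min ?G 1 = mean_min F 1" using B by (simp add: T)
  have "mean_min F x \<le> mean_min ?G x" if "x \<in> {0..1}" for x
  proof (cases "x \<le> B")
    case True
    then show ?thesis using dom[OF that] by (simp add: T)
  next
    case False
    then show ?thesis using B(3) F.mean_min_mono[of x 1] that by (simp add: T)
  qed
  then have "bayes_plausible F ?G" using T(1) G1 by (simp add: bayes_plausible_iff[OF assms(2)])
  moreover have "buyer_surplus ?G (seller_price H) = mean_min F 1 - r" if "admissible \<eta> ?G H" for H
    using seller_price_truncated_pareto[OF assms(1) \<open>0 < r\<close> B(1,2) that] \<open>0 < r\<close> \<open>r \<le> 1\<close> B
      mean_min_pareto_below[OF assms(1) \<open>0 < r\<close>, of r] G1
    by (simp add: buyer_surplus_eq[OF T(1)] T(2))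
  then have "robust_surplus \<eta> ?G = (INF H\<in>{H. admissible \<eta> ?G H}. mean_min F 1 - r)"
    unfolding robust_surplus_def by (intro INF_cong) auto
  then have "robust_surplus \<eta> ?G = mean_min F 1 - r"
    using admissible_self[OF assms(1) T(1)] by (subst (asm) cINF_const) auto
  ultimately show ?thesis using that[of B] B by blast
qed

text \<open>Mass near 1 makes the mean positive. Mass near 0 makes \<open>min s x\<close> fall below
  \<open>x\<close> with positive probability, which excludes a contact with the Pareto law at
  \<open>x = r\<close>.\<close>

lemma full_support_mean_min:
  assumes "unit_distribution F" "msupport F = {0..1}"
  shows full_support_mean_min_less: "0 < x \<Longrightarrow> mean_min F x < x"
    and full_support_mean_pos: "0 < mean_min F 1"
proof -
  interpret F: nonneg_distribution F using assms(1) by (rule unit_distribution_nonneg_distribution)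
  have pos: "0 < measure F U" if "open U" "s \<in> U" "s \<in> {0..1}" for U s
    using that assms(2) by (auto simp: msupport_def set_eq_iff)
  have "0 < (1 / 2) * measure F {1 / 2<..}" using pos[of "{1 / 2<..}" 1] by simp
  also have "\<dots> \<le> (1 / 2) * measure F {1 / 2..}" by (intro mult_left_mono F.finite_measure_mono) auto
  also have "\<dots> \<le> mean_min F (1 / 2)" by (rule F.tail_le_mean_min) simp
  also have "\<dots> \<le> mean_min F 1" by (rule F.mean_min_mono) auto
  finally show "0 < mean_min F 1" .
  assume x: "0 < x"
  have "mean_min F x \<le> mean_min F (x / 2) + (LINT s|F. x / 2 * indicator {x / 2..} s)"
  proof -
    have "mean_min F x \<le> (LINT s|F. min s (x / 2) + x / 2 * indicator {x / 2..} s)"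
      unfolding mean_min_def using x
      by (intro integral_mono Bochner_Integration.integrable_add F.integrable_min F.integrable_scaled_tail)
        (auto simp: indicator_def)
    also have "\<dots> = mean_min F (x / 2) + (LINT s|F. x / 2 * indicator {x / 2..} s)"
      unfolding mean_min_def
      by (rule Bochner_Integration.integral_add[OF F.integrable_min F.integrable_scaled_tail]) (use x in simp)
    finally show ?thesis .
  qed
  also have "\<dots> = mean_min F (x / 2) + x / 2 * measure F {x / 2..}"
    by (simp add: F.emeasure_eq_measure)
  also have "\<dots> < x / 2 + x / 2"
  proof (intro add_le_less_mono)
    show "mean_min F (x / 2) \<le> x / 2" using x by (intro F.mean_min_le) simp
    have "measure F {x / 2..} < 1"
      using F.prob_compl[of "{x / 2..}"] pos[of "{..<x / 2}" 0] x
      by (simp add: Compl_eq_Diff_UNIV[symmetric])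
    then show "x / 2 * measure F {x / 2..} < x / 2" using x by simp
  qed
  finally show "mean_min F x < x" by simp
qed

text \<open>The nonnegative variable \<open>p - min s p\<close> has mean 0, so
  \<open>s \<ge> p\<close> almost surely.\<close>

lemma tail_eq_1_of_mean_min_eq:
  assumes "unit_distribution G" "0 \<le> p" "mean_min G p = p" "q \<le> p"
  shows "measure G {q..} = 1"
proof -
  interpret G: nonneg_distribution G using assms(1) by (rule unit_distribution_nonneg_distribution)
  have "(LINT s|G. p - min s p) = 0"
    using assms(2,3) G.prob_space by (simp add: mean_min_def G.integrable_min)
  then have "AE s in G. p - min s p = 0"
    using assms(2) by (subst (asm) integral_nonneg_eq_0_iff_AE) (auto simp: G.integrable_min)
  then have "AE s in G. s \<in> {q..}"
    using assms(4) by (auto elim!: eventually_mono simp: min_def split: if_splits)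
  then show ?thesis by (intro G.prob_eq_1[THEN iffD2]) auto
qed

theorem mainTheorem1:
  fixes F :: "real measure" and \<eta> :: real
  assumes "\<eta> \<ge> 0"
    and "unit_distribution F"
    and "continuous_on UNIV (cdf F)"
    and "msupport F = {0..1}"
  shows "(\<exists>G. buyer_optimal \<eta> F G)
    \<and> (\<forall>G H. buyer_optimal \<eta> F G \<and> admissible \<eta> G H \<longrightarrow> measure G {seller_price H..} = 1)
    \<and> (\<exists>r B G. 0 \<le> r \<and> r \<le> B \<and> B \<le> 1
         \<and> buyer_optimal \<eta> F G
         \<and> msupport G = {r..B}
         \<and> (\<forall>p. r < p \<and> p \<le> B \<longrightarrow> measure G {p..} = disagreement_inv \<eta> (r / p))
         \<and> (\<forall>H. admissible \<eta> G H \<longrightarrow> seller_price H = r))"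
proof -
  note \<eta> = assms(1) and F = assms(2)
  have m: "0 < mean_min F 1" using full_support_mean_pos[OF F assms(4)] .
  obtain r where r: "feasible \<eta> F r" "\<And>r'. feasible \<eta> F r' \<Longrightarrow> r \<le> r'" "r \<le> mean_min F 1"
    "\<exists>x\<in>{r..1}. mean_min (pareto \<eta> r) x \<le> mean_min F x"
    using least_feasible[OF \<eta> F m] by blast
  obtain B where B: "r \<le> B" "B \<le> 1" "bayes_plausible F (truncated_pareto \<eta> r B)"
    "robust_surplus \<eta> (truncated_pareto \<eta> r B) = mean_min F 1 - r"
    using feasible_truncated_pareto[OF \<eta> F r(1,3)] by blast
  let ?G = "truncated_pareto \<eta> r B"
  have "0 < r" using r(1) by (simp add: feasible_def)
  have "robust_surplus \<eta> G \<le> mean_min F 1 - r" if "bayes_plausible F G" for G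
  proof (rule robust_surplus_feasible[OF \<eta> F that m])
    fix p assume "feasible \<eta> F (mean_min G p)" "robust_surplus \<eta> G \<le> mean_min F 1 - mean_min G p"
    then show ?thesis using r(2)[of "mean_min G p"] by simp
  qed
  then have opt: "buyer_optimal \<eta> F ?G"
    using B by (force simp: buyer_optimal_def is_arg_max_def not_less)
  have trade: "measure G {seller_price H..} = 1"
    if G: "buyer_optimal \<eta> F G" and H: "admissible \<eta> G H" for G H
  proof -
    have bp: "bayes_plausible F G" using G by (simp add: buyer_optimal_def is_arg_max_def)
    have uG: "unit_distribution G" and FG: "\<And>x. x \<in> {0..1} \<Longrightarrow> mean_min F x \<le> mean_min G x"
      using bp bayes_plausible_iff[OF F] by auto
    interpret G: nonneg_distribution G using uG by (rule unit_distribution_nonneg_distribution)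
    interpret Q: nonneg_distribution "pareto \<eta> r" using \<eta> \<open>0 < r\<close> by (rule nonneg_distribution_pareto)
    obtain p where price: "\<forall>H. admissible \<eta> G H \<longrightarrow> seller_price H \<le> p"
      and p: "p \<in> {0..1}" "feasible \<eta> F (mean_min G p)"
      "robust_surplus \<eta> G \<le> mean_min F 1 - mean_min G p"
      "\<forall>x\<ge>p. mean_min G x \<le> mean_min (pareto \<eta> (mean_min G p)) (x - p + mean_min G p)"
      by (rule robust_surplus_feasible[OF \<eta> F bp m])
    have "mean_min F 1 - r \<le> robust_surplus \<eta> G"
      using G B by (auto simp: buyer_optimal_def is_arg_max_def not_less)
    \<comment> \<open>Optimality gives \<open>mean_min G p \<le> r\<close>, and minimality of
      \<open>r\<close> among feasible prices gives the converse.\<close>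
    then have Gp: "mean_min G p = r" using p(3) r(2)[OF p(2)] by simp
    obtain x where x: "x \<in> {r..1}" "mean_min (pareto \<eta> r) x \<le> mean_min F x" using r(4) by blast
    have "p \<le> r"
    proof (rule ccontr)
      assume "\<not> p \<le> r"
      show False
      proof (cases "p \<le> x")
        case True
        \<comment> \<open>At the contact point the shift by \<open>p - r > 0\<close> is strict:
          \<rho> of \<open>G\<close>, hence of \<open>F\<close>, would lie below \<rho> of the
          Pareto law.\<close>
        have "mean_min (pareto \<eta> r) (x - p + r) < mean_min (pareto \<eta> r) x"
          using True \<open>\<not> p \<le> r\<close> by (intro mean_min_pareto_strict_mono \<eta> \<open>0 < r\<close>) auto
        then show False using p(4)[rule_format, OF True] FG[of x] x \<open>0 < r\<close> by (simp add: Gp)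
      next
        case False
        \<comment> \<open>A contact before \<open>p\<close> has \<rho> at most
          \<open>mean_min G p = r\<close>, which forces \<open>x = r\<close>; full support excludes
          this.\<close>
        have "mean_min (pareto \<eta> r) x \<le> r"
          using x FG[of x] G.mean_min_mono[of x p] False \<open>0 < r\<close> Gp by auto
        then have "x = r"
          using mean_min_pareto_strict_mono[OF \<eta> \<open>0 < r\<close>, of r x] x
            mean_min_pareto_below[OF \<eta> \<open>0 < r\<close>, of r] by force
        then show False
          using x full_support_mean_min_less[OF F assms(4) \<open>0 < r\<close>]
            mean_min_pareto_below[OF \<eta> \<open>0 < r\<close>, of r] by simp
      qed
    qed
    \<comment> \<open>Now \<open>p \<le> r = mean_min G p \<le> p\<close>, so all signals are almost
      surely at least \<open>p\<close>, and \<open>p\<close> bounds every induced price.\<close>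
    then have "mean_min G p = p" using Gp G.mean_min_le[of p] p(1) by auto
    then show ?thesis using tail_eq_1_of_mean_min_eq[OF uG, of p "seller_price H"] p(1) price H by simp
  qed
  have "0 \<le> r \<and> r \<le> B \<and> B \<le> 1 \<and> buyer_optimal \<eta> F ?G \<and> msupport ?G = {r..B}
    \<and> (\<forall>p. r < p \<and> p \<le> B \<longrightarrow> measure ?G {p..} = disagreement_inv \<eta> (r / p))
    \<and> (\<forall>H. admissible \<eta> ?G H \<longrightarrow> seller_price H = r)"
    using \<open>0 < r\<close> B(1,2) opt msupport_truncated_pareto[OF \<eta> \<open>0 < r\<close> B(1,2)]
      truncated_pareto_tail_mid[OF \<eta> \<open>0 < r\<close> B(1,2)]
      seller_price_truncated_pareto[OF \<eta> \<open>0 < r\<close> B(1,2)] by auto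
  with opt trade show ?thesis by blast
qed

end
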